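(* Let $n$ be a non-negative integer, let $\xi=(n,k,\lambda)\in\mathfrak{P}^{\mathrm{stab}}(n)$, and let $\psi(\xi)=(n+2,k+1,\lambda)$. Then $$\mathfrak{c}(\xi)=\mathfrak{c}(\psi(\xi))$$ as elements of $L(\Lambda_{\overline n})$.
   Context: Affine Lie algebra. $\mathfrak{sl}_2$ is the complex Lie algebra of trace-zero $2\times2$ matrices with standard basis $x=\begin{pmatrix}0&1\\0&0\end{pmatrix}$, $h=\begin{pmatrix}1&0\\0&-1\end{pmatrix}$, $y=\begin{pmatrix}0&0\\1&0\end{pmatrix}$ and form $(A,B)=\mathrm{trace}(AB)$. $\widehat{\mathfrak{sl}_2}=\mathfrak{sl}_2\otimes\mathbb{C}[t,t^{-1}]\oplus\mathbb{C}c\oplus\mathbb{C}d$, where $At^m$ means $A\otimes t^m$, $c$ is central, $[At^m,Bt^n]=[A,B]t^{m+n}+m\,\delta_{m,-n}(A,B)c$ and $[d,At^m]=mAt^m$. The Cartan subalgebra is $\widehat{\mathfrak h}=\mathbb{C}h\oplus\mathbb{C}c\oplus\mathbb{C}d$. Chevalley generators: $e_1=x$, $f_1=y$, $e_0=yt$, $f_0=xt^{-1}$; simple coroots $\alpha_1^\vee=h$, $\alpha_0^\vee=c-h$. The simple root $\alpha_1\in\widehat{\mathfrak h}^*$ takes values $2,0,0$ on $h,c,d$; $\delta$ takes values $0,0,1$ on $h,c,d$. $\Lambda_0$ takes values $0,1,0$ on $h,c,d$, and $\Lambda_1=\Lambda_0+\tfrac12\alpha_1-\tfrac14\delta$. For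 a dominant integral weight $\Lambda$, $L(\Lambda)$ is the irreducible $\widehat{\mathfrak{sl}_2}$-module of highest weight $\Lambda$; $v_{\Lambda_i}$ is a fixed highest weight vector of $L(\Lambda_i)$, $i=0,1$. For $n\ge0$, $\overline n=0$ if $n$ is even and $\overline n=1$ if $n$ is odd. Divided powers: $X^{(p)}=X^p/p!$. Define $w_n\in L(\Lambda_{\overline n})$ by $w_n=(xt^{-n/2})^{(n/2)}v_{\Lambda_0}$ for $n$ even and $w_n=(xt^{-(n+1)/2})^{((n-1)/2)}v_{\Lambda_1}$ for $n$ odd. (The vector $w_n$ generates, over the current algebra $\mathfrak{sl}_2[t]$, a copy of the local Weyl module $W(n)$ inside $L(\Lambda_{\overline n})$.) A partition $\lambda=(\lambda_1\ge\lambda_2\ge\cdots)$ is a weakly decreasing sequence of non-negative integers, eventually zero; $|\lambda|=\sum_i\lambda_i$; $\mathrm{supp}\,\lambda$ is the number of non-zero parts. $\mathfrak{P}(n)$ is the set of triples $(n,k,\lambda)$ with $k$ an integer, $0\le k\le n$, and $\lambda$ a partition with $\lambda_1\le k$ and $\mathrm{supp}\,\lambda\le n-k$. For $\xi=(n,k,\lambda)\in\mathfrak{P}(n)$ define $$\mathfrak{c}(\xi)=z(\xi)\Big(\prod_{i=1}^{n-k}yt^{k-\lambda_i}\Big)w_n\in L(\Lambda_{\overline n}),\qquad z(\xi)=\frac{(-1)^{[n/4]-[(n-k)/2]}}{\prod_{j=0}^k m_j!},$$ where $[\cdot]$ is the floor function, $m_j=\#\{i:\lambda_i=j\}$ for $j\ge1$,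 and $m_0=n-k-\mathrm{supp}\,\lambda$. The stable set is $\mathfrak{P}^{\mathrm{stab}}(n)=\{(n,k,\lambda)\in\mathfrak{P}(n):|\lambda|\le\min(n-k,k)\}$ if $n$ is even, and $\{(n,k,\lambda)\in\mathfrak{P}(n):|\lambda|\le\min(n-k,k-1)\}$ if $n$ is odd. If $(n,k,\lambda)\in\mathfrak{P}(n)$ then $(n+2,k+1,\lambda)\in\mathfrak{P}(n+2)$. *)

theory Defs
  imports "HOL-Analysis.Analysis" "HOL-Library.Poly_Mapping"
begin

section \<open>The affine Lie algebra of type A_1^(1)\<close>

definition mat_scale :: "complex \<Rightarrow> complex^2^2 \<Rightarrow> complex^2^2" where
  "mat_scale s A = (\<chi> i. s *s (A $ i))"

definition commutator :: "complex^2^2 \<Rightarrow> complex^2^2 \<Rightarrow> complex^2^2" where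
  "commutator A B = A ** B - B ** A"

definition sl2 :: "(complex^2^2) set" where
  "sl2 = {A. trace A = 0}"

definition sl2_x :: "complex^2^2" where "sl2_x = vector [vector [0, 1], vector [0, 0]]"
definition sl2_h :: "complex^2^2" where "sl2_h = vector [vector [1, 0], vector [0, -1]]"
definition sl2_y :: "complex^2^2" where "sl2_y = vector [vector [0, 0], vector [1, 0]]"

text \<open>A triple \<open>(f, a, b)\<close> stands for the sum of the \<open>(f m) t^m\<close> plus \<open>a c + b d\<close>.\<close>

type_synonym affine = "(int \<Rightarrow>\<^sub>0 complex^2^2) \<times> complex \<times> complex"

definition affine_sl2 :: "affine set" where
  "affine_sl2 = {(f, a, b). \<forall>m. Poly_Mapping.lookup f m \<in> sl2}"

definition affine_scale :: "complex \<Rightarrow> affine \<Rightarrow> affine" where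
  "affine_scale s = (\<lambda>(f, a, b). (Poly_Mapping.map (mat_scale s) f, s * a, s * b))"

definition loop :: "complex^2^2 \<Rightarrow> int \<Rightarrow> affine" where
  "loop A m = (Poly_Mapping.single m A, 0, 0)"

definition central_c :: affine where "central_c = (0, 1, 0)"

definition degree_d :: affine where "degree_d = (0, 0, 1)"

definition loop_commutator ::
    "(int \<Rightarrow>\<^sub>0 complex^2^2) \<Rightarrow> (int \<Rightarrow>\<^sub>0 complex^2^2) \<Rightarrow> (int \<Rightarrow>\<^sub>0 complex^2^2)" where
  "loop_commutator f g =
     (\<Sum>m\<in>Poly_Mapping.keys f. \<Sum>n\<in>Poly_Mapping.keys g.
        Poly_Mapping.single (m + n)
          (commutator (Poly_Mapping.lookup f m) (Poly_Mapping.lookup g n)))"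

definition loop_cocycle ::
    "(int \<Rightarrow>\<^sub>0 complex^2^2) \<Rightarrow> (int \<Rightarrow>\<^sub>0 complex^2^2) \<Rightarrow> complex" where
  "loop_cocycle f g =
     (\<Sum>m\<in>Poly_Mapping.keys f. \<Sum>n\<in>Poly_Mapping.keys g.
        if m = - n
        then of_int m * trace (Poly_Mapping.lookup f m ** Poly_Mapping.lookup g n) else 0)"

text \<open>The derivation \<open>t d/dt\<close>, i.e. the adjoint action of \<open>d\<close> on the loop algebra.\<close>

definition loop_deriv :: "(int \<Rightarrow>\<^sub>0 complex^2^2) \<Rightarrow> (int \<Rightarrow>\<^sub>0 complex^2^2)" where
  "loop_deriv f =
     (\<Sum>m\<in>Poly_Mapping.keys f.
        Poly_Mapping.single m (mat_scale (of_int m) (Poly_Mapping.lookup f m)))"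

definition affine_bracket :: "affine \<Rightarrow> affine \<Rightarrow> affine" where
  "affine_bracket = (\<lambda>(f, a, b) (g, a', b').
     (loop_commutator f g
        + Poly_Mapping.map (mat_scale b) (loop_deriv g)
        - Poly_Mapping.map (mat_scale b') (loop_deriv f),
      loop_cocycle f g, 0))"

lemma mat_scale_0 [simp]: "mat_scale s 0 = 0" "mat_scale 0 A = 0"
  by (simp_all add: mat_scale_def vec_eq_iff)

lemma mat_scale_1 [simp]: "mat_scale 1 A = A"
  by (simp add: mat_scale_def vec_eq_iff)

lemma poly_mapping_map_mat_scale [simp]:
  "Poly_Mapping.map (mat_scale 1) f = f"
  "Poly_Mapping.map (mat_scale 0) f = 0"
  by (auto intro!: poly_mapping_eqI simp: Poly_Mapping.map.rep_eq when_def)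

lemma poly_mapping_map_mat_scale_0 [simp]: "Poly_Mapping.map (mat_scale s) 0 = 0"
  by (auto intro!: poly_mapping_eqI simp: Poly_Mapping.map.rep_eq when_def)

lemma commutator_0 [simp]: "commutator 0 A = 0" "commutator A 0 = 0"
  by (simp_all add: commutator_def)

lemma trace_zero_matrix [simp]: "trace (0 :: complex^2^2) = 0"
  by (simp add: trace_def)

lemma loop_operations_single:
  "loop_commutator (Poly_Mapping.single m A) (Poly_Mapping.single n B) =
     Poly_Mapping.single (m + n) (commutator A B)"
  "loop_cocycle (Poly_Mapping.single m A) (Poly_Mapping.single n B) =
     (if m = - n then of_int m * trace (A ** B) else 0)"
  "loop_deriv (Poly_Mapping.single m A) = Poly_Mapping.single m (mat_scale (of_int m) A)"
  by (cases "A = 0"; cases "B = 0";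
      simp add: loop_commutator_def loop_cocycle_def loop_deriv_def)+

lemma loop_operations_0 [simp]:
  "loop_commutator 0 f = 0" "loop_commutator f 0 = 0"
  "loop_cocycle 0 f = 0" "loop_cocycle f 0 = 0" "loop_deriv 0 = 0"
  by (simp_all add: loop_commutator_def loop_cocycle_def loop_deriv_def)

lemma affine_bracket_loop_loop:
  "affine_bracket (loop A m) (loop B n) =
     loop (commutator A B) (m + n)
       + affine_scale (if m = - n then of_int m * trace (A ** B) else 0) central_c"
  by (simp add: affine_bracket_def loop_def loop_operations_single affine_scale_def central_c_def)

lemma affine_bracket_d_loop:
  "affine_bracket degree_d (loop A m) = loop (mat_scale (of_int m) A) m"
  "affine_bracket (loop A m) degree_d = - loop (mat_scale (of_int m) A) m"
  by (simp_all add: affine_bracket_def loop_def loop_operations_single degree_d_def)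

lemma affine_bracket_central:
  "affine_bracket central_c u = 0" "affine_bracket u central_c = 0"
  by (auto simp: affine_bracket_def central_c_def zero_prod_def split: prod.splits)

section \<open>Weights\<close>

definition cartan :: "affine set" where
  "cartan = {affine_scale a (loop sl2_h 0) + affine_scale b central_c + affine_scale e degree_d
             | a b e. True}"

text \<open>
  Weights are functionals on \<open>cartan\<close>; the formulas below make sense on all of \<open>affine\<close>, but only
  their values on \<open>cartan\<close> matter. On \<open>a h + b c + e d\<close> the loop part is \<open>a h\<close> in degree 0, whose
  upper left entry is \<open>a\<close>.
\<close>

definition alpha1 :: "affine \<Rightarrow> complex" where
  "alpha1 = (\<lambda>(f, b, e). 2 * (Poly_Mapping.lookup f 0 $ 1 $ 1))"

definition null_root :: "affine \<Rightarrow> complex" where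
  "null_root = (\<lambda>(f, b, e). e)"

definition Lambda0 :: "affine \<Rightarrow> complex" where
  "Lambda0 = (\<lambda>(f, b, e). b)"

definition Lambda1 :: "affine \<Rightarrow> complex" where
  "Lambda1 H = Lambda0 H + alpha1 H / 2 - null_root H / 4"

definition fundamental_weight :: "nat \<Rightarrow> affine \<Rightarrow> complex" where
  "fundamental_weight i = (if i = 0 then Lambda0 else Lambda1)"

lemma weight_values:
  "alpha1 (loop sl2_h 0) = 2" "alpha1 central_c = 0" "alpha1 degree_d = 0"
  "null_root (loop sl2_h 0) = 0" "null_root central_c = 0" "null_root degree_d = 1"
  "Lambda0 (loop sl2_h 0) = 0" "Lambda0 central_c = 1" "Lambda0 degree_d = 0"
  by (simp_all add: alpha1_def null_root_def Lambda0_def loop_def sl2_h_def central_c_def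
        degree_d_def)

section \<open>Irreducible highest weight modules\<close>

locale affine_sl2_module = vector_space smul
  for smul :: "complex \<Rightarrow> 'v::ab_group_add \<Rightarrow> 'v" +
  fixes act :: "affine \<Rightarrow> 'v \<Rightarrow> 'v"
  assumes act_linear: "u \<in> affine_sl2 \<Longrightarrow> Vector_Spaces.linear smul smul (act u)"
    and act_add: "u \<in> affine_sl2 \<Longrightarrow> u' \<in> affine_sl2 \<Longrightarrow> act (u + u') v = act u v + act u' v"
    and act_scale: "u \<in> affine_sl2 \<Longrightarrow> act (affine_scale s u) v = smul s (act u v)"
    and act_bracket: "u \<in> affine_sl2 \<Longrightarrow> u' \<in> affine_sl2 \<Longrightarrow>
      act (affine_bracket u u') v = act u (act u' v) - act u' (act u v)"
begin

definition submodule :: "'v set \<Rightarrow> bool" where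
  "submodule W \<longleftrightarrow> subspace W \<and> (\<forall>u\<in>affine_sl2. \<forall>w\<in>W. act u w \<in> W)"

definition irreducible_module :: bool where
  "irreducible_module \<longleftrightarrow>
     (\<exists>v::'v. v \<noteq> 0) \<and> (\<forall>W. submodule W \<longrightarrow> W = {0} \<or> W = UNIV)"

text \<open>
  The elements \<open>e_1 = x\<close> and \<open>e_0 = y t\<close> generate the positive nilpotent part.
\<close>

definition highest_weight_vector :: "(affine \<Rightarrow> complex) \<Rightarrow> 'v \<Rightarrow> bool" where
  "highest_weight_vector \<Lambda> v \<longleftrightarrow>
     v \<noteq> 0 \<and> act (loop sl2_x 0) v = 0 \<and> act (loop sl2_y 1) v = 0 \<and>
     (\<forall>H\<in>cartan. act H v = smul (\<Lambda> H) v)"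

end

text \<open>
  The whole type \<open>'v\<close>, with scalar multiplication \<open>smul\<close> and action \<open>act\<close>, is a realization of
  \<open>L(\<Lambda>)\<close>, and \<open>v0\<close> is a highest weight vector in it. Since \<open>L(\<Lambda>)\<close> is determined only up to
  isomorphism, results about it are stated for every such realization.
\<close>

locale irreducible_highest_weight_module = affine_sl2_module smul act
  for smul :: "complex \<Rightarrow> 'v::ab_group_add \<Rightarrow> 'v" and act :: "affine \<Rightarrow> 'v \<Rightarrow> 'v" +
  fixes \<Lambda> :: "affine \<Rightarrow> complex" and v0 :: 'v
  assumes irreducible: "irreducible_module"
    and highest_weight_vector: "highest_weight_vector \<Lambda> v0"

section \<open>The vectors \<open>w_n\<close>\<close>

definition divided_power ::
    "(complex \<Rightarrow> 'v::ab_group_add \<Rightarrow> 'v) \<Rightarrow> ('v \<Rightarrow> 'v) \<Rightarrow> nat \<Rightarrow> 'v \<Rightarrow> 'v" where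
  "divided_power smul X p v = smul (1 / fact p) ((X ^^ p) v)"

text \<open>
  Here \<open>v\<close> is to be a highest weight vector of weight \<open>fundamental_weight (n mod 2)\<close>.
\<close>

definition weyl_vector ::
    "(complex \<Rightarrow> 'v::ab_group_add \<Rightarrow> 'v) \<Rightarrow> (affine \<Rightarrow> 'v \<Rightarrow> 'v) \<Rightarrow> 'v \<Rightarrow> nat \<Rightarrow> 'v" where
  "weyl_vector smul act v n =
     (if even n
      then divided_power smul (act (loop sl2_x (- int (n div 2)))) (n div 2) v
      else divided_power smul (act (loop sl2_x (- int ((n + 1) div 2)))) ((n - 1) div 2) v)"

section \<open>The index set and the vectors \<open>c(\<xi>)\<close>\<close>

text \<open>Partitions are indexed from 0: the part usually written \<open>\<mu>_i\<close> with \<open>i \<ge> 1\<close> is \<open>\<mu> (i - 1)\<close>.\<close>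

definition is_partition :: "(nat \<Rightarrow> nat) \<Rightarrow> bool" where
  "is_partition \<mu> \<longleftrightarrow> antimono \<mu> \<and> finite {i. \<mu> i \<noteq> 0}"

definition partition_size :: "(nat \<Rightarrow> nat) \<Rightarrow> nat" where
  "partition_size \<mu> = (\<Sum>i | \<mu> i \<noteq> 0. \<mu> i)"

definition partition_supp :: "(nat \<Rightarrow> nat) \<Rightarrow> nat" where
  "partition_supp \<mu> = card {i. \<mu> i \<noteq> 0}"

type_synonym pattern = "nat \<times> nat \<times> (nat \<Rightarrow> nat)"

definition patterns :: "nat \<Rightarrow> pattern set" where
  "patterns n = {(n, k, \<mu>) | k \<mu>.
     k \<le> n \<and> is_partition \<mu> \<and> \<mu> 0 \<le> k \<and> partition_supp \<mu> \<le> n - k}"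

text \<open>The bound is taken in \<open>int\<close> because \<open>k - 1\<close> may be \<open>-1\<close>, in which case nothing is stable.\<close>

definition stable_patterns :: "nat \<Rightarrow> pattern set" where
  "stable_patterns n = {(n, k, \<mu>) | k \<mu>. (n, k, \<mu>) \<in> patterns n \<and>
     int (partition_size \<mu>) \<le>
       (if even n then min (int n - int k) (int k) else min (int n - int k) (int k - 1))}"

definition part_mult :: "pattern \<Rightarrow> nat \<Rightarrow> nat" where
  "part_mult = (\<lambda>(n, k, \<mu>) j.
     if j = 0 then n - k - partition_supp \<mu> else card {i. \<mu> i = j})"

text \<open>The exponent of \<open>-1\<close> can be negative, hence \<open>powi\<close>.\<close>

definition norm_coeff :: "pattern \<Rightarrow> complex" where
  "norm_coeff = (\<lambda>(n, k, \<mu>).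
     ((-1) powi (int (n div 4) - int ((n - k) div 2)))
       / (\<Prod>j=0..k. fact (part_mult (n, k, \<mu>) j)))"

text \<open>
  The operators \<open>y t^m\<close> commute on every module, so the order of the factors is immaterial; the list
  below puts the factor for the first part outermost.
\<close>

definition basis_vector ::
    "(complex \<Rightarrow> 'v::ab_group_add \<Rightarrow> 'v) \<Rightarrow> (affine \<Rightarrow> 'v \<Rightarrow> 'v) \<Rightarrow> 'v \<Rightarrow> pattern \<Rightarrow> 'v" where
  "basis_vector smul act v = (\<lambda>(n, k, \<mu>).
     smul (norm_coeff (n, k, \<mu>))
       (foldr (\<lambda>i. act (loop sl2_y (int k - int (\<mu> i)))) [0..<n - k] (weyl_vector smul act v n)))"

definition pattern_shift :: "pattern \<Rightarrow> pattern" where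
  "pattern_shift = (\<lambda>(n, k, \<mu>). (n + 2, k + 1, \<mu>))"

end

theory Submission
  imports Defs
begin

text \<open>
  Write \<open>r = n - k\<close>. The vector \<open>w_n\<close> is extremal: \<open>x t^j w_n = 0\<close> for \<open>j \<ge> -n\<close> and
  \<open>h t^i w_n = 0\<close> for \<open>i > 0\<close>. Commuting \<open>h t^{-j}\<close> past a product of operators \<open>y t^{k - \<lambda>_i}\<close>
  expresses the product with an additional part \<open>j\<close> through products with fewer positive parts, by a
  recursion that depends neither on \<open>k\<close> nor on \<open>n\<close>. Therefore only the vectors \<open>(y t^k)^{(r)} g w_n\<close>
  have to be compared, with \<open>g\<close> a product of operators \<open>h t^{-j}\<close> of total degree at most
  \<open>r\<close>. In that range \<open>x t^{-k}\<close> kills \<open>g w_n\<close>, hence \<open>(y t^k)^{(r)}\<close> acts as a Weyl reflection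
  and moves past \<open>g\<close> up to the parity of the number of its factors. What is left is \<open>\<lambda> = 0\<close>,
  where both sides are extremal vectors and only the sign matters.

  Irreducibility enters through the absence of singular vectors below the highest weight. It makes
  the simple root vectors locally nilpotent, which bounds the weights and thus makes \<open>w_n\<close> extremal.
\<close>

section \<open>Divided powers and commutators\<close>

abbreviation (input) endo :: "(complex \<Rightarrow> 'v::ab_group_add \<Rightarrow> 'v) \<Rightarrow> ('v \<Rightarrow> 'v) \<Rightarrow> bool" where
  "endo smul a \<equiv> Vector_Spaces.linear smul smul a"

locale complex_space = vector_space smul
  for smul :: "complex \<Rightarrow> 'v::ab_group_add \<Rightarrow> 'v"
begin

lemma endoI:
  assumes "\<And>x y. a (x + y) = a x + a y" "\<And>c x. a (smul c x) = smul c (a x)"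
  shows "endo smul a"
  using assms by unfold_locales

lemma endo_simps:
  assumes "endo smul a"
  shows "a (x + y) = a x + a y" "a (x - y) = a x - a y" "a (- x) = - a x" "a 0 = 0"
    "a (smul c x) = smul c (a x)"
  using assms by (simp_all add: linear_iff_module_hom module_hom.add module_hom.diff module_hom.neg
      module_hom.zero module_hom.scale)

text \<open>Exponents are integers and negative divided powers are 0, so that the commutation formulas
  below hold for all exponents.\<close>

definition dpow :: "('v \<Rightarrow> 'v) \<Rightarrow> int \<Rightarrow> 'v \<Rightarrow> 'v" where
  "dpow a p u = (if p < 0 then 0 else divided_power smul a (nat p) u)"

lemma dpow_0 [simp]: "dpow a 0 u = u"
  by (simp add: dpow_def divided_power_def)

lemma dpow_neg [simp]: "p < 0 \<Longrightarrow> dpow a p u = 0"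
  by (simp add: dpow_def)

lemma dpow_of_nat: "dpow a (int p) u = smul (1 / fact p) ((a ^^ p) u)"
  by (simp add: dpow_def divided_power_def)

lemma funpow_eq_dpow: "(a ^^ p) u = smul (fact p) (dpow a (int p) u)"
  by (simp add: dpow_of_nat)

lemma dpow_step:
  assumes "endo smul a"
  shows "a (dpow a p u) = smul (of_int (p + 1)) (dpow a (p + 1) u)"
proof (cases "p < 0")
  case True
  then show ?thesis
    by (cases "p = - 1") (simp_all add: endo_simps[OF assms])
next
  case False
  then obtain q where p: "p = int q" by (metis nonneg_int_cases not_less)
  have "dpow a (p + 1) u = smul (1 / fact (Suc q)) ((a ^^ Suc q) u)"
    using dpow_of_nat[of a "Suc q" u] by (simp add: p add.commute)
  moreover have "(fact q + fact q * of_nat q :: complex) \<noteq> 0"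
    using fact_nonzero[of "Suc q", where ?'a = complex] by (simp add: algebra_simps)
  ultimately show ?thesis
    by (simp add: p dpow_of_nat endo_simps[OF assms] field_simps)
qed

lemma dpow_Suc:
  assumes "endo smul a"
  shows "dpow a (int (Suc p)) u = smul (1 / of_nat (Suc p)) (a (dpow a (int p) u))"
  by (simp add: dpow_step[OF assms] add.commute del: of_nat_Suc)
    (metis (no_types, lifting) divide_self_if nat.distinct(1) of_nat_Suc of_nat_eq_0_iff scale_one)

lemma dpow_1 [simp]: "endo smul a \<Longrightarrow> dpow a 1 u = a u"
  using dpow_step[of a 0 u] by simp

lemma endo_dpow:
  assumes "endo smul a"
  shows "endo smul (dpow a p)"
proof (cases "p < 0")
  case True
  then show ?thesis by (intro endoI) simp_all
next
  case False
  then obtain q where p: "p = int q" by (metis nonneg_int_cases not_less)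
  have "endo smul (dpow a (int q))"
  proof (induction q)
    case (Suc q)
    show ?case
      by (intro endoI)
        (simp_all only: dpow_Suc[OF assms] endo_simps[OF Suc] endo_simps[OF assms]
          scale_right_distrib scale_left_commute)
  qed (auto intro!: endoI)
  then show ?thesis by (simp add: p)
qed

text \<open>The Leibniz rule: each of the \<open>p\<close> factors contributes one copy of
  \<open>e = [c, a]\<close>. These commute with \<open>a\<close> and collect into \<open>p\<close>
  times one term with a factor \<open>a\<close> fewer; the divided power absorbs the
  \<open>p\<close>.\<close>

lemma dpow_bracket1:
  assumes a: "endo smul a" and c: "endo smul c"
    and ca: "\<And>u. c (a u) = a (c u) + e u" and ea: "\<And>u. e (a u) = a (e u)"
  shows "c (dpow a p u) = dpow a p (c u) + dpow a (p - 1) (e u)"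
proof (cases "p < 0")
  case True
  then show ?thesis by (simp add: endo_simps[OF c])
next
  case False
  then obtain q where p: "p = int q" by (metis nonneg_int_cases not_less)
  \<comment> \<open>Linearity of \<open>e\<close> comes from writing it as the commutator of
    \<open>c\<close> and \<open>a\<close>.\<close>
  have e0: "e u = c (a u) - a (c u)" for u using ca[of u] by simp
  have e: "endo smul e"
    by (intro endoI)
      (simp_all add: e0 endo_simps[OF a] endo_simps[OF c] scale_right_diff_distrib)
  have ed: "e (dpow a (int q) u) = dpow a (int q) (e u)" for q u
    by (induction q) (simp_all only: dpow_Suc[OF a] endo_simps[OF e] ea of_nat_0 dpow_0)
  have "c (dpow a (int q) u) = dpow a (int q) (c u) + dpow a (int q - 1) (e u)"
  proof (induction q)
    case (Suc q)
    let ?n = "of_nat (Suc q) :: complex"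
    have "c (dpow a (int (Suc q)) u) = smul (1 / ?n) (c (a (dpow a (int q) u)))"
      by (simp only: dpow_Suc[OF a] endo_simps[OF c])
    also have "c (a (dpow a (int q) u)) =
        a (dpow a (int q) (c u)) + a (dpow a (int q - 1) (e u)) + dpow a (int q) (e u)"
      by (simp add: ca Suc endo_simps[OF a] ed)
    also have "\<dots> = smul ?n (dpow a (int (Suc q)) (c u)) + smul ?n (dpow a (int q) (e u))"
      by (simp add: dpow_step[OF a] add.commute algebra_simps)
    finally show ?case
      by (simp add: scale_right_distrib del: of_nat_Suc) simp
  qed (simp)
  then show ?thesis by (simp add: p)
qed

lemma dpow_commute:
  assumes "endo smul a" "endo smul b" "\<And>u. b (a u) = a (b u)"
  shows "b (dpow a p u) = dpow a p (b u)"
  using dpow_bracket1[of a b "\<lambda>_. 0" p u] assms endo_simps(4)[OF endo_dpow] by (simp add: endo_simps)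

text \<open>The expansion of a conjugation by \<open>exp a\<close>, cut off after the second bracket
  because \<open>e = [[b, a], a]\<close> commutes with \<open>a\<close>. It applies to all modes
  since \<open>ad (X k)\<close> and \<open>ad (Y k)\<close> have vanishing cube.\<close>

lemma dpow_bracket2:
  assumes a: "endo smul a" and b: "endo smul b" and c: "endo smul c"
    and ba: "\<And>u. b (a u) = a (b u) + c u"
    and ca: "\<And>u. c (a u) = a (c u) + e u" and ea: "\<And>u. e (a u) = a (e u)"
  shows "b (dpow a p u) =
    dpow a p (b u) + dpow a (p - 1) (c u) + smul (1 / 2) (dpow a (p - 2) (e u))"
proof (cases "p < 0")
  case True
  then show ?thesis by (simp add: endo_simps[OF b])
next
  case False
  then obtain q where p: "p = int q" by (metis nonneg_int_cases not_less)
  have "b (dpow a (int q) u) = dpow a (int q) (b u) + dpow a (int q - 1) (c u)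
      + smul (1 / 2) (dpow a (int q - 2) (e u))"
  proof (induction q)
    case (Suc q)
    have index: "int (Suc q) - 1 = int q" "int (Suc q) - 2 = int q - 1" by simp_all
    let ?n = "of_nat (Suc q) :: complex"
    have "b (dpow a (int (Suc q)) u) = smul (1 / ?n) (b (a (dpow a (int q) u)))"
      by (simp only: dpow_Suc[OF a] endo_simps[OF b])
    also have "b (a (dpow a (int q) u)) =
        a (dpow a (int q) (b u)) + a (dpow a (int q - 1) (c u))
        + smul (1 / 2) (a (dpow a (int q - 2) (e u)))
        + (dpow a (int q) (c u) + dpow a (int q - 1) (e u))"
      by (simp add: ba Suc endo_simps[OF a]
            dpow_bracket1[where a = a and c = c and e = e, OF a c ca ea])
    also have "\<dots> = smul ?n (dpow a (int (Suc q)) (b u)) + smul ?n (dpow a (int q) (c u))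
        + (smul ((of_int (int q) - 1) / 2) (dpow a (int q - 1) (e u)) + dpow a (int q - 1) (e u))"
    proof -
      have "smul (of_nat q / 2) x = smul (1 / 2) x + smul ((of_nat q - 1) / 2) x" for x
        by (simp add: diff_divide_distrib flip: scale_left_distrib)
      then show ?thesis by (simp add: dpow_step[OF a] add.commute algebra_simps)
    qed
    \<comment> \<open>The coefficient \<open>1 / 2\<close> propagates because
      \<open>(q - 1) / 2 + 1 = (q + 1) / 2\<close>.\<close>
    also have "smul ((of_int (int q) - 1) / 2) (dpow a (int q - 1) (e u)) + dpow a (int q - 1) (e u)
        = smul (?n / 2) (dpow a (int q - 1) (e u))"
    proof -
      have "?n / 2 = (of_int (int q) - 1) / 2 + 1" by (simp add: field_simps)
      then show ?thesis by (simp only: scale_left_distrib scale_one)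
    qed
    finally show ?case
      by (simp add: scale_right_distrib index del: of_nat_Suc)
  qed (simp)
  then show ?thesis by (simp add: p)
qed

text \<open>With \<open>c\<close> to the left of the divided power instead; moving it across costs
  one full \<open>e\<close> term, which turns the coefficient \<open>1 / 2\<close> into
  \<open>- 1 / 2\<close>.\<close>

lemma dpow_bracket2':
  assumes a: "endo smul a" and b: "endo smul b" and c: "endo smul c"
    and ba: "\<And>u. b (a u) = a (b u) + c u"
    and ca: "\<And>u. c (a u) = a (c u) + e u" and ea: "\<And>u. e (a u) = a (e u)"
  shows "b (dpow a p u) =
    dpow a p (b u) + c (dpow a (p - 1) u) - smul (1 / 2) (dpow a (p - 2) (e u))"
proof -
  have h: "smul (1 / 2) x + smul (1 / 2) x = x" for x
    by (simp flip: scale_left_distrib)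
  have "c (dpow a (p - 1) u) = dpow a (p - 1) (c u) + dpow a (p - 2) (e u)"
    using dpow_bracket1[where a = a and c = c and e = e, OF a c ca ea, of "p - 1" u] by simp
  then show ?thesis
    using dpow_bracket2[where a = a and b = b and c = c and e = e, OF a b c ba ca ea, of p u]
      h[of "dpow a (p - 2) (e u)"]
    by (simp add: algebra_simps)
qed

lemma dpow_eigen:
  assumes a: "endo smul a" and c: "endo smul c"
    and ca: "\<And>u. c (a u) = a (c u) + smul t (a u)"
  shows "c (dpow a p u) = dpow a p (c u) + smul (t * of_int p) (dpow a p u)"
proof -
  have "c (dpow a p u) = dpow a p (c u) + dpow a (p - 1) (smul t (a u))"
    by (rule dpow_bracket1[OF a c]) (simp_all add: ca endo_simps[OF a])
  also have "dpow a (p - 1) (smul t (a u)) = smul t (a (dpow a (p - 1) u))"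
    using dpow_commute[OF a a, of "p - 1" u] by (simp add: endo_simps[OF endo_dpow[OF a]])
  finally show ?thesis by (simp add: dpow_step[OF a])
qed

section \<open>Local nilpotency\<close>

definition nilpotent_at :: "('v \<Rightarrow> 'v) \<Rightarrow> 'v \<Rightarrow> bool" where
  "nilpotent_at a u \<longleftrightarrow> (\<exists>N. (a ^^ N) u = 0)"

lemma funpow_eq_0_iff: "(a ^^ N) u = 0 \<longleftrightarrow> dpow a (int N) u = 0"
  by (simp add: dpow_of_nat)

lemma funpow_eq_0_mono:
  assumes "endo smul a" "(a ^^ N) u = 0" "N \<le> N'"
  shows "(a ^^ N') u = 0"
proof -
  have "(a ^^ k) 0 = 0" for k by (induction k) (simp_all add: endo_simps[OF assms(1)])
  then show ?thesis
    using assms by (metis funpow_add le_add_diff_inverse2 o_apply)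
qed

text \<open>If \<open>a ^^ N\<close> kills \<open>u\<close>, then every term in the expansion of the
  power \<open>N + 2\<close> at \<open>b u\<close> has at least \<open>N\<close> factors
  \<open>a\<close> acting on \<open>u\<close>, since \<open>c\<close> may stand on the left and
  \<open>e\<close> commutes with \<open>a\<close>.\<close>

lemma nilpotent_at_bracket:
  assumes a: "endo smul a" and b: "endo smul b" and c: "endo smul c"
    and ba: "\<And>u. b (a u) = a (b u) + c u"
    and ca: "\<And>u. c (a u) = a (c u) + e u" and ea: "\<And>u. e (a u) = a (e u)"
    and "nilpotent_at a u"
  shows "nilpotent_at a (b u)"
proof -
  obtain N where N: "(a ^^ N) u = 0" using assms(7) by (auto simp: nilpotent_at_def)
  have z: "dpow a (int N + int k) u = 0" for k
    using funpow_eq_0_mono[OF a N, of "N + k"] by (simp add: funpow_eq_0_iff)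
  have e0: "e u = c (a u) - a (c u)" for u using ca[of u] by simp
  have e: "endo smul e"
    by (intro endoI)
      (simp_all add: e0 endo_simps[OF a] endo_simps[OF c] scale_right_diff_distrib)
  have "dpow a (int N) (e u) = 0"
    using dpow_commute[where a = a and b = e, OF a e ea, of "int N" u] z[of 0] by (simp add: endo_simps[OF e])
  then have "dpow a (int N + 2) (b u) = 0"
    using dpow_bracket2'[where a = a and b = b and c = c and e = e, OF a b c ba ca ea, of "int N + 2" u]
      z[of 2] z[of 1]
    by (simp add: endo_simps[OF b] endo_simps[OF c] add.commute)
  then have "(a ^^ (N + 2)) (b u) = 0"
    by (simp add: funpow_eq_0_iff add.commute del: funpow.simps funpow_add)
  then show ?thesis unfolding nilpotent_at_def by blast
qed

end

section \<open>Triples generating sl2\<close>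

locale sl2_triple = complex_space smul
  for smul :: "complex \<Rightarrow> 'v::ab_group_add \<Rightarrow> 'v" +
  fixes e h f :: "'v \<Rightarrow> 'v"
  assumes endo_e: "endo smul e" and endo_h: "endo smul h" and endo_f: "endo smul f"
    and ef: "e (f u) = f (e u) + h u"
    and he: "h (e u) = e (h u) + smul 2 (e u)"
    and hf: "h (f u) = f (h u) - smul 2 (f u)"
begin

lemma e_dpow_f:
  "e (dpow f p u) = dpow f p (e u) + dpow f (p - 1) (h u) - smul (of_int (p - 1)) (dpow f (p - 1) u)"
proof -
  have "e (dpow f p u) = dpow f p (e u) + dpow f (p - 1) (h u)
      + smul (1 / 2) (dpow f (p - 2) (smul (- 2) (f u)))"
    by (rule dpow_bracket2[OF endo_f endo_e endo_h]) (simp_all add: ef hf endo_simps[OF endo_f])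
  also have "dpow f (p - 2) (smul (- 2) (f u)) = smul (- 2) (f (dpow f (p - 2) u))"
    using dpow_commute[OF endo_f endo_f, of "p - 2" u] by (simp add: endo_simps[OF endo_dpow[OF endo_f]])
  also have "f (dpow f (p - 2) u) = smul (of_int (p - 1)) (dpow f (p - 1) u)"
    by (simp add: dpow_step[OF endo_f])
  finally show ?thesis
    by (simp add: scale_minus_left[symmetric] del: scale_minus_left)
qed

lemma e_dpow_f_highest:
  assumes "e u = 0" "h u = smul r u"
  shows "e (dpow f p u) = smul (r - of_int (p - 1)) (dpow f (p - 1) u)"
  using e_dpow_f[of p u] assms
  by (simp add: endo_simps[OF endo_dpow[OF endo_f]] scale_left_diff_distrib)

text \<open>For the least \<open>N\<close> with \<open>(f ^^ N) u = 0\<close>, applying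
  \<open>e\<close> to this null vector gives \<open>r - (N - 1)\<close> times a non-zero vector,
  hence \<open>N = r + 1\<close>.\<close>

lemma dpow_f_eq_0:
  assumes "e u = 0" "h u = smul (of_nat r) u" "nilpotent_at f u"
  shows "dpow f (int r + 1) u = 0"
proof (cases "u = 0")
  case True
  then show ?thesis by (simp add: endo_simps[OF endo_dpow[OF endo_f]])
next
  case False
  define N where "N = (LEAST N. (f ^^ N) u = 0)"
  have N: "(f ^^ N) u = 0"
    using assms(3) unfolding nilpotent_at_def N_def by (rule LeastI_ex)
  have "N \<noteq> 0" using N False by (metis funpow_0)
  then have "(f ^^ (N - 1)) u \<noteq> 0"
    unfolding N_def by (intro not_less_Least) simp
  then have nz: "dpow f (int N - 1) u \<noteq> 0"
    using funpow_eq_0_iff[of "N - 1" f u] \<open>N \<noteq> 0\<close> by (simp add: of_nat_diff)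
  have "smul (of_nat r - of_int (int N - 1)) (dpow f (int N - 1) u) = 0"
    using e_dpow_f_highest[OF assms(1,2), of "int N"] N
    by (simp add: funpow_eq_0_iff endo_simps[OF endo_e])
  then have "(of_nat r :: complex) = of_int (int N - 1)"
    using nz by (simp add: scale_eq_0_iff)
  then have "of_int (int r) = (of_int (int N - 1) :: complex)" by simp
  then have "int r = int N - 1" by (simp only: of_int_eq_iff)
  then have "int r + 1 = int N" by simp
  then show ?thesis using N by (simp add: funpow_eq_0_iff)
qed

lemma dpow_e_dpow_f:
  assumes "e u = 0" "h u = smul (of_nat r) u" "p \<le> r"
  shows "dpow e (int p) (dpow f (int r) u) = dpow f (int r - int p) u"
  using assms(3)
proof (induction p)
  case (Suc p)
  then have "dpow e (int (Suc p)) (dpow f (int r) u) =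
      smul (1 / of_nat (Suc p)) (e (dpow f (int r - int p) u))"
    by (simp only: dpow_Suc[OF endo_e] Suc_leD)
  also have "e (dpow f (int r - int p) u) = smul (of_nat (Suc p)) (dpow f (int r - int (Suc p)) u)"
    using e_dpow_f_highest[OF assms(1,2), of "int r - int p"] by (simp add: algebra_simps)
  finally show ?case by (simp del: of_nat_Suc)
qed simp

text \<open>Induction on the nilpotency order of \<open>e\<close>: the vector \<open>e b\<close>
  satisfies the same hypotheses with \<open>p + 2\<close> for \<open>p\<close>, so
  \<open>e b = 0\<close>. Then \<open>b\<close> is a highest weight vector and is recovered from its
  lowest vector. The lemma keeps reflected weight vectors non-zero.\<close>

lemma weight_reflection_injective:
  assumes "h b = smul (of_nat p) b" "nilpotent_at e b" "(f ^^ p) b = 0"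
  shows "b = 0"
proof -
  obtain s where "(e ^^ s) b = 0" using assms(2) by (auto simp: nilpotent_at_def)
  then show ?thesis using assms(1,3)
  proof (induction s arbitrary: b p)
    case (Suc s)
    have z: "dpow f (int p + int k) b = 0" for k
      using funpow_eq_0_mono[OF endo_f Suc.prems(3), of "p + k"] by (simp add: funpow_eq_0_iff)
    have "e b = 0"
    proof (rule Suc.IH)
      show "(e ^^ s) (e b) = 0" using Suc.prems(1) by (simp add: funpow_swap1)
      show "h (e b) = smul (of_nat (p + 2)) (e b)"
        by (simp add: he Suc.prems(2) endo_simps[OF endo_e] scale_left_distrib)
      show "(f ^^ (p + 2)) (e b) = 0"
        using e_dpow_f[of "int (p + 2)" b] z[of 2] z[of 1]
        by (simp add: funpow_eq_0_iff Suc.prems(2) endo_simps[OF endo_dpow[OF endo_f]]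
            endo_simps[OF endo_e] add.commute del: funpow.simps funpow_add)
    qed
    then show ?case
      using dpow_e_dpow_f[of b p p] Suc.prems(2) z[of 0] by (simp add: endo_simps[OF endo_dpow[OF endo_e]])
  qed simp
qed

end

section \<open>Irreducible highest weight modules of level one\<close>

text \<open>The modes stand for \<open>x t^m\<close>, \<open>y t^m\<close>, \<open>h t^m\<close> and
  \<open>d\<close>. The central element acts as 1, so it shows only through the scalars in
  \<open>XY\<close> and \<open>HH\<close>. The highest weight has values \<epsilon> at
  \<open>h\<close> and \<delta> at \<open>d\<close>; only differences from \<delta> matter.\<close>

locale level_one = complex_space smul
  for smul :: "complex \<Rightarrow> 'v::ab_group_add \<Rightarrow> 'v" +
  fixes X Y H :: "int \<Rightarrow> 'v \<Rightarrow> 'v" and D :: "'v \<Rightarrow> 'v"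
    and \<epsilon> :: nat and \<delta> :: complex and v :: 'v
  assumes endo_X: "endo smul (X m)" and endo_Y: "endo smul (Y m)"
    and endo_H: "endo smul (H m)" and endo_D: "endo smul D"
    and XY: "X m (Y n u) = Y n (X m u) + H (m + n) u + smul (if m + n = 0 then of_int m else 0) u"
    and HX: "H m (X n u) = X n (H m u) + smul 2 (X (m + n) u)"
    and HY: "H m (Y n u) = Y n (H m u) - smul 2 (Y (m + n) u)"
    and HH: "H m (H n u) = H n (H m u) + smul (if m + n = 0 then 2 * of_int m else 0) u"
    and XX: "X m (X n u) = X n (X m u)" and YY: "Y m (Y n u) = Y n (Y m u)"
    and DX: "D (X n u) = X n (D u) + smul (of_int n) (X n u)"
    and DY: "D (Y n u) = Y n (D u) + smul (of_int n) (Y n u)"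
    and DH: "D (H n u) = H n (D u) + smul (of_int n) (H n u)"
    and irreducible: "subspace W \<Longrightarrow>
      (\<And>w n. w \<in> W \<Longrightarrow> X n w \<in> W \<and> Y n w \<in> W \<and> H n w \<in> W \<and> D w \<in> W) \<Longrightarrow>
      W = {0} \<or> W = UNIV"
    and v_nonzero: "v \<noteq> 0" and X0_v: "X 0 v = 0" and Y1_v: "Y 1 v = 0"
    and H0_v: "H 0 v = smul (of_nat \<epsilon>) v" and D_v: "D v = smul \<delta> v"
    and eps: "\<epsilon> \<le> 1"
begin

lemmas X_simps = endo_simps[OF endo_X] and Y_simps = endo_simps[OF endo_Y]
  and H_simps = endo_simps[OF endo_H] and D_simps = endo_simps[OF endo_D]

lemmas dpow_X_simps = endo_simps[OF endo_dpow[OF endo_X]]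
  and dpow_Y_simps = endo_simps[OF endo_dpow[OF endo_Y]]

lemma X_dpow_X: "X m (dpow (X n) p u) = dpow (X n) p (X m u)"
  by (rule dpow_commute[where a = "X n" and b = "X m", OF endo_X endo_X XX])

lemma Y_dpow_Y: "Y m (dpow (Y n) p u) = dpow (Y n) p (Y m u)"
  by (rule dpow_commute[where a = "Y n" and b = "Y m", OF endo_Y endo_Y YY])

lemma YX: "Y n (X m u) = X m (Y n u) - H (m + n) u - smul (if m + n = 0 then of_int m else 0) u"
  by (simp add: XY)

lemma XH: "X n (H m u) = H m (X n u) - smul 2 (X (m + n) u)"
  by (simp add: HX)

lemma YH: "Y n (H m u) = H m (Y n u) + smul 2 (Y (m + n) u)"
  by (simp add: HY)

text \<open>Every real root gives a copy of sl2; the shift by \<open>k\<close> is the central term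
  in \<open>[x t^(-k), y t^k] = h - k c\<close>.\<close>

lemma triple_XY: "sl2_triple smul (X (- k)) (\<lambda>u. H 0 u - smul (of_int k) u) (Y k)"
  by unfold_locales
    (auto simp: X_simps Y_simps H_simps XY HX HY algebra_simps)

lemma triple_YX: "sl2_triple smul (Y k) (\<lambda>u. smul (of_int k) u - H 0 u) (X (- k))"
  by unfold_locales
    (auto simp: X_simps Y_simps H_simps XY HX HY algebra_simps)

section \<open>Singular vectors and a bound on degrees\<close>

definition singular :: "'v \<Rightarrow> bool" where
  "singular s \<longleftrightarrow> X 0 s = 0 \<and> Y 1 s = 0 \<and> (\<exists>h. H 0 s = smul h s) \<and> (\<exists>d. D s = smul d s)"

text \<open>The simple root vectors generate: \<open>[x, y t] = h t\<close>, and repeated brackets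
  with \<open>h t\<close> reach all of the positive part.\<close>

lemma singular_positive:
  assumes "singular s"
  shows "m \<ge> 0 \<Longrightarrow> X m s = 0" "m \<ge> 1 \<Longrightarrow> Y m s = 0" "m \<ge> 1 \<Longrightarrow> H m s = 0"
proof -
  have s: "X 0 s = 0" "Y 1 s = 0" using assms by (auto simp: singular_def)
  have h1: "H 1 s = 0" using XY[of 0 1 s] s by (simp add: X_simps Y_simps)
  have x: "X (int k) s = 0" for k
  proof (induction k)
    case (Suc k)
    then show ?case using HX[of 1 "int k" s] h1 by (simp add: X_simps H_simps)
  qed (simp add: s)
  have y: "Y (1 + int k) s = 0" for k
  proof (induction k)
    case (Suc k)
    then show ?case using HY[of 1 "1 + int k" s] h1 by (simp add: Y_simps H_simps)
  qed (simp add: s)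
  show "m \<ge> 0 \<Longrightarrow> X m s = 0" using x[of "nat m"] by simp
  show "m \<ge> 1 \<Longrightarrow> Y m s = 0" using y[of "nat (m - 1)"] by simp
  then show "m \<ge> 1 \<Longrightarrow> H m s = 0"
    using XY[of 0 m s] s by (simp add: X_simps Y_simps)
qed

text \<open>This is \<open>U(n_-) s\<close>. The words in negative operators are not put in any
  order, so rule induction takes the place of a PBW basis.\<close>

inductive_set descendants :: "'v \<Rightarrow> 'v set" for s where
  base: "s \<in> descendants s"
| zero: "0 \<in> descendants s"
| add: "x \<in> descendants s \<Longrightarrow> y \<in> descendants s \<Longrightarrow> x + y \<in> descendants s"
| scale: "x \<in> descendants s \<Longrightarrow> smul c x \<in> descendants s"
| X: "x \<in> descendants s \<Longrightarrow> m < 0 \<Longrightarrow> X m x \<in> descendants s"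
| Y: "x \<in> descendants s \<Longrightarrow> m \<le> 0 \<Longrightarrow> Y m x \<in> descendants s"
| H: "x \<in> descendants s \<Longrightarrow> m < 0 \<Longrightarrow> H m x \<in> descendants s"

lemma descendants_diff:
  "x \<in> descendants s \<Longrightarrow> y \<in> descendants s \<Longrightarrow> x - y \<in> descendants s"
  using descendants.add[of x s "smul (- 1) y"] descendants.scale[of y s "- 1"] by simp

text \<open>A mode is commuted past the outermost negative operator; the bracket is again a mode, up
  to a scalar term, applied to a shorter word. Hence all modes are treated in one induction.\<close>

lemma descendants_invariant:
  assumes s: "singular s" and "w \<in> descendants s"
  shows "(\<forall>m. X m w \<in> descendants s \<and> Y m w \<in> descendants s \<and> H m w \<in> descendants s)
    \<and> D w \<in> descendants s"
  using assms(2)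
proof induction
  case base
  obtain h d where "H 0 s = smul h s" "D s = smul d s" using s by (auto simp: singular_def)
  then show ?case
    using singular_positive[OF s] descendants.intros
    by (metis linorder_not_le int_one_le_iff_zero_less order_le_less)
next
  case zero
  then show ?case by (simp add: X_simps Y_simps H_simps D_simps descendants.zero)
next
  case (add x y)
  then show ?case by (simp add: X_simps Y_simps H_simps D_simps descendants.add)
next
  case (scale x c)
  then show ?case by (simp add: X_simps Y_simps H_simps D_simps descendants.scale)
next
  case (X x m)
  then show ?case
    by (auto simp: XX[of _ m] YX[of _ m] HX[of _ m] DX
        intro!: descendants.add descendants_diff descendants.scale descendants.X[OF _ X.hyps(2)])
next
  case (Y x m)
  then show ?case
    by (auto simp: XY[of _ m] YY[of _ m] HY[of _ m] DY
        intro!: descendants.add descendants_diff descendants.scale descendants.Y[OF _ Y.hyps(2)])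
next
  case (H x m)
  then show ?case
    by (auto simp: XH[of _ m] YH[of _ m] HH[of _ m] DH
        intro!: descendants.add descendants_diff descendants.scale descendants.H[OF _ H.hyps(2)])
qed

lemma descendants_UNIV:
  assumes "singular s" "s \<noteq> 0"
  shows "descendants s = UNIV"
proof -
  have "subspace (descendants s)"
    unfolding subspace_def by (auto intro: descendants.intros)
  then show ?thesis
    using irreducible[of "descendants s"] descendants_invariant[OF assms(1)]
      descendants.base[of s] assms(2) by auto
qed

text \<open>The principal grading, scaled to have integral degrees.\<close>

definition G :: "'v \<Rightarrow> 'v" where "G u = smul 4 (D u) + H 0 u"

text \<open>A polynomial in \<open>G\<close>, given by its list of roots. It replaces a
  decomposition into weight spaces: degrees are read off from annihilating polynomials.\<close>

definition G_prod :: "complex list \<Rightarrow> 'v \<Rightarrow> 'v" where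
  "G_prod \<gamma>s u = foldr (\<lambda>\<gamma> w. G w - smul \<gamma> w) \<gamma>s u"

lemma G_prod_Cons: "G_prod (\<gamma> # \<gamma>s) u = G (G_prod \<gamma>s u) - smul \<gamma> (G_prod \<gamma>s u)"
  and G_prod_Nil: "G_prod [] u = u"
  by (simp_all add: G_prod_def)

lemma endo_G: "endo smul G"
  by (intro endoI) (simp_all add: G_def D_simps H_simps algebra_simps)

lemma endo_G_prod: "endo smul (G_prod \<gamma>s)"
proof (induction \<gamma>s)
  case Nil
  show ?case by (intro endoI) (simp_all add: G_prod_Nil)
next
  case (Cons \<gamma> \<gamma>s)
  show ?case
    by (intro endoI) (simp_all add: G_prod_Cons endo_simps[OF Cons] endo_simps[OF endo_G] algebra_simps)
qed

lemma G_prod_append: "G_prod (\<gamma>s @ \<gamma>s') u = G_prod \<gamma>s (G_prod \<gamma>s' u)"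
  by (simp add: G_prod_def)

lemma G_prod_commute: "G_prod \<gamma>s (G_prod \<gamma>s' u) = G_prod \<gamma>s' (G_prod \<gamma>s u)"
proof -
  have G: "G (G_prod \<gamma>s u) = G_prod \<gamma>s (G u)" for \<gamma>s u
    by (induction \<gamma>s arbitrary: u) (simp_all add: G_prod_Cons G_prod_Nil endo_simps[OF endo_G])
  show ?thesis
    by (induction \<gamma>s) (simp_all add: G_prod_Cons G_prod_Nil endo_simps[OF endo_G_prod] G)
qed

lemma G_prod_shift:
  assumes a: "endo smul a" and "\<And>u. G (a u) = a (G u) + smul t (a u)"
  shows "G_prod (map (\<lambda>\<gamma>. \<gamma> + t) \<gamma>s) (a u) = a (G_prod \<gamma>s u)"
  by (induction \<gamma>s) (simp_all add: G_prod_Cons G_prod_Nil assms(2) endo_simps[OF a] algebra_simps)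

lemma G_X: "G (X m u) = X m (G u) + smul (4 * of_int m + 2) (X m u)"
  by (simp add: G_def DX HX X_simps algebra_simps)

lemma G_Y: "G (Y m u) = Y m (G u) + smul (4 * of_int m - 2) (Y m u)"
  by (simp add: G_def DY HY Y_simps algebra_simps)

lemma G_H: "G (H m u) = H m (G u) + smul (4 * of_int m) (H m u)"
proof -
  have "H 0 (H m u) = H m (H 0 u)" by (subst HH) simp
  then show ?thesis by (simp add: G_def DH H_simps algebra_simps)
qed

text \<open>The factor \<open>G - g\<close> kills \<open>s\<close>. Negative operators shift the
  roots by their degrees \<open>4 m + 2\<close>, \<open>4 m - 2\<close> and \<open>4 m\<close>,
  which are negative here; for a sum the two lists of roots are concatenated.\<close>

lemma descendants_annihilated:
  assumes "w \<in> descendants s" "G s = smul g s"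
  shows "\<exists>\<gamma>s. (\<forall>\<gamma>\<in>set \<gamma>s. \<exists>j. \<gamma> = g - of_nat j) \<and> G_prod \<gamma>s w = 0"
proof -
  have op: "\<exists>\<gamma>s. (\<forall>\<gamma>\<in>set \<gamma>s. \<exists>j. \<gamma> = g - of_nat j) \<and> G_prod \<gamma>s (a x) = 0"
    if "\<exists>\<gamma>s. (\<forall>\<gamma>\<in>set \<gamma>s. \<exists>j. \<gamma> = g - of_nat j) \<and> G_prod \<gamma>s x = 0"
      and a: "endo smul a" and Ga: "\<And>u. G (a u) = a (G u) + smul (of_int t) (a u)" and "t \<le> 0"
    for a x t
  proof -
    obtain \<gamma>s where \<gamma>s: "\<forall>\<gamma>\<in>set \<gamma>s. \<exists>j. \<gamma> = g - of_nat j" "G_prod \<gamma>s x = 0"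
      using \<open>\<exists>\<gamma>s. _ \<gamma>s\<close> by blast
    have "\<exists>j. \<gamma> + of_int t = g - of_nat j" if "\<gamma> = g - of_nat i" for \<gamma> i
      using that \<open>t \<le> 0\<close> by (intro exI[of _ "i + nat (- t)"]) (simp add: of_nat_nat)
    then have "\<forall>\<gamma>\<in>set (map (\<lambda>\<gamma>. \<gamma> + of_int t) \<gamma>s). \<exists>j. \<gamma> = g - of_nat j"
      using \<gamma>s(1) by auto
    moreover have "G_prod (map (\<lambda>\<gamma>. \<gamma> + of_int t) \<gamma>s) (a x) = 0"
      by (simp add: G_prod_shift[OF a Ga] \<gamma>s(2) endo_simps[OF a])
    ultimately show ?thesis by blast
  qed
  show ?thesis
    using assms(1)
  proof induction
    case base
    have "G_prod [g] s = 0" by (simp add: G_prod_Cons G_prod_Nil assms(2))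
    then show ?case by (intro exI[of _ "[g]"]) (auto intro!: exI[of _ 0])
  next
    case zero
    show ?case by (intro exI[of _ "[]"]) (simp add: G_prod_Nil)
  next
    case (add x y)
    then obtain \<gamma>s \<gamma>s' where
      "\<forall>\<gamma>\<in>set (\<gamma>s @ \<gamma>s'). \<exists>j. \<gamma> = g - of_nat j" "G_prod \<gamma>s x = 0" "G_prod \<gamma>s' y = 0"
      by (metis UnE set_append)
    then show ?case
      by (intro exI[of _ "\<gamma>s @ \<gamma>s'"])
        (simp add: G_prod_append endo_simps[OF endo_G_prod] G_prod_commute[of \<gamma>s \<gamma>s' x])
  next
    case (scale x c)
    then show ?case by (auto simp: endo_simps[OF endo_G_prod])
  next
    case (X x m)
    show ?case by (rule op[OF X.IH endo_X, where t = "4 * m + 2"]) (use X.hyps in \<open>simp_all add: G_X\<close>)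
  next
    case (Y x m)
    show ?case by (rule op[OF Y.IH endo_Y, where t = "4 * m - 2"]) (use Y.hyps in \<open>simp_all add: G_Y\<close>)
  next
    case (H x m)
    show ?case by (rule op[OF H.IH endo_H, where t = "4 * m"]) (use H.hyps in \<open>simp_all add: G_H\<close>)
  qed
qed

text \<open>The singular vector generates the whole module, so \<open>b\<close> is killed by a
  product of factors \<open>G - \<gamma>\<close> with each root \<gamma> below \<open>g\<close> by a
  natural number. On \<open>b\<close> this product is a scalar, so one factor
  \<open>\<beta> - \<gamma>\<close> is zero.\<close>

lemma singular_bound:
  assumes "singular s" "s \<noteq> 0" "G s = smul g s" "G b = smul \<beta> b" "b \<noteq> 0"
  shows "\<exists>j. \<beta> = g - of_nat j"
proof -
  obtain \<gamma>s where \<gamma>s: "\<forall>\<gamma>\<in>set \<gamma>s. \<exists>j. \<gamma> = g - of_nat j" "G_prod \<gamma>s b = 0"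
    using descendants_annihilated[of b s g] descendants_UNIV assms by blast
  have "G_prod \<gamma>s b = smul (\<Prod>\<gamma>\<leftarrow>\<gamma>s. \<beta> - \<gamma>) b" for \<gamma>s
    by (induction \<gamma>s)
      (simp_all add: G_prod_Cons G_prod_Nil endo_simps[OF endo_G] assms(4) algebra_simps
        flip: scale_left_diff_distrib)
  then have "(\<Prod>\<gamma>\<leftarrow>\<gamma>s. \<beta> - \<gamma>) = 0" using \<gamma>s(2) assms(5) by (simp add: scale_eq_0_iff)
  then show ?thesis using \<gamma>s(1) by (auto simp: prod_list_zero_iff)
qed

lemma singular_v: "singular v"
  using X0_v Y1_v H0_v D_v by (auto simp: singular_def)

lemma G_v: "G v = smul (4 * \<delta> + of_nat \<epsilon>) v"
  by (simp add: G_def H0_v D_v scale_left_distrib)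

text \<open>A non-zero \<open>s\<close> would generate \<open>v\<close>, which would then have
  degree at most that of \<open>s\<close>.\<close>

lemma singular_below_v:
  assumes "singular s" "G s = smul (4 * \<delta> + of_nat \<epsilon> - of_nat (Suc j)) s"
  shows "s = 0"
proof (rule ccontr)
  assume "s \<noteq> 0"
  then obtain i where "4 * \<delta> + of_nat \<epsilon> = 4 * \<delta> + of_nat \<epsilon> - of_nat (Suc j) - of_nat i"
    using singular_bound[OF assms(1) _ assms(2) G_v v_nonzero] by blast
  then have "(of_nat (Suc j + i) :: complex) = 0" by (simp add: algebra_simps)
  then show False by (simp only: of_nat_eq_0_iff)
qed

section \<open>Integrability\<close>

text \<open>The weight has value \<epsilon> at the coroot \<open>h\<close>, so this vector is
  singular; its degree lies \<open>2 * (\<epsilon> + 1)\<close> below that of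
  \<open>v\<close>.\<close>

lemma dpow_Y0_v: "dpow (Y 0) (int \<epsilon> + 1) v = 0" (is "?s = 0")
proof (rule singular_below_v)
  have H: "H 0 ?s = smul (of_nat \<epsilon> - 2 * (of_nat \<epsilon> + 1)) ?s"
    using dpow_eigen[OF endo_Y endo_H, of 0 0 "- 2" "int \<epsilon> + 1" v]
    by (simp add: HY H0_v dpow_Y_simps flip: scale_left_distrib)
  have D: "D ?s = smul \<delta> ?s"
    using dpow_eigen[OF endo_Y endo_D, of 0 0 "int \<epsilon> + 1" v]
    by (simp add: DY D_v dpow_Y_simps)
  have "X 0 ?s = 0"
    using sl2_triple.e_dpow_f_highest[OF triple_XY, of 0 v "of_nat \<epsilon>" "int \<epsilon> + 1"]
    by (simp add: X0_v H0_v)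
  moreover have "Y 1 ?s = 0"
    by (simp only: Y_dpow_Y Y1_v dpow_Y_simps(4))
  ultimately show "singular ?s" unfolding singular_def using H D by blast
  show "G ?s = smul (4 * \<delta> + of_nat \<epsilon> - of_nat (Suc (2 * \<epsilon> + 1))) ?s"
    by (simp add: G_def H D flip: scale_left_distrib)
qed

text \<open>The null vector of the other simple root, whose coroot \<open>c - h\<close> has value
  \<open>1 - \<epsilon>\<close>; the degree drops by \<open>2 * (2 - \<epsilon>)\<close>.\<close>

lemma dpow_X1_v: "dpow (X (- 1)) (2 - int \<epsilon>) v = 0" (is "?s = 0")
proof (rule singular_below_v)
  have H: "H 0 ?s = smul (of_nat \<epsilon> + 2 * (2 - of_nat \<epsilon>)) ?s"
    using dpow_eigen[OF endo_X endo_H, of 0 "- 1" "2" "2 - int \<epsilon>" v]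
    by (simp add: HX H0_v dpow_X_simps flip: scale_left_distrib)
  have D: "D ?s = smul (\<delta> - (2 - of_nat \<epsilon>)) ?s"
    using dpow_eigen[OF endo_X endo_D, of "- 1" "- 1" "2 - int \<epsilon>" v]
    by (simp add: DX D_v dpow_X_simps flip: scale_left_distrib)
  have "Y 1 ?s = 0"
  proof -
    have "smul (of_int 1) v - H 0 v = smul (1 - of_nat \<epsilon>) v"
      by (simp add: H0_v scale_left_diff_distrib)
    from sl2_triple.e_dpow_f_highest[OF triple_YX Y1_v this, of "2 - int \<epsilon>"]
    show ?thesis by simp
  qed
  moreover have "X 0 ?s = 0"
    by (simp only: X_dpow_X X0_v dpow_X_simps(4))
  ultimately show "singular ?s" unfolding singular_def using H D by blast
  \<comment> \<open>These subtractions are in \<open>nat\<close>; \<open>\<epsilon> \<le> 1\<close>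
    keeps them exact.\<close>
  have "Suc (3 - 2 * \<epsilon>) = 4 - 2 * \<epsilon>" "2 * \<epsilon> \<le> 4" using eps by linarith+
  then have "4 * (\<delta> - (2 - of_nat \<epsilon>)) + (of_nat \<epsilon> + 2 * (2 - of_nat \<epsilon>)) =
      4 * \<delta> + of_nat \<epsilon> - of_nat (Suc (3 - 2 * \<epsilon>))"
    by (simp only: of_nat_diff) (simp add: algebra_simps)
  moreover have "G ?s = smul (4 * (\<delta> - (2 - of_nat \<epsilon>)) + (of_nat \<epsilon> + 2 * (2 - of_nat \<epsilon>))) ?s"
    by (simp only: G_def H D scale_scale scale_left_distrib)
  ultimately show "G ?s = smul (4 * \<delta> + of_nat \<epsilon> - of_nat (Suc (3 - 2 * \<epsilon>))) ?s"
    by (simp only:)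
qed

text \<open>The vectors at which \<open>a\<close> is nilpotent form a submodule containing
  \<open>v\<close>.\<close>

lemma nilpotent_everywhere:
  assumes a: "endo smul a" and v: "nilpotent_at a v"
    and "\<And>u n. nilpotent_at a u \<Longrightarrow> nilpotent_at a (X n u)"
    and "\<And>u n. nilpotent_at a u \<Longrightarrow> nilpotent_at a (Y n u)"
    and "\<And>u n. nilpotent_at a u \<Longrightarrow> nilpotent_at a (H n u)"
    and "\<And>u. nilpotent_at a u \<Longrightarrow> nilpotent_at a (D u)"
  shows "nilpotent_at a u"
proof -
  have lin: "(a ^^ N) (x + y) = (a ^^ N) x + (a ^^ N) y"
    "(a ^^ N) (smul c x) = smul c ((a ^^ N) x)" for N x y c
    by (induction N) (simp_all add: endo_simps[OF a])
  have "subspace {u. nilpotent_at a u}"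
    unfolding subspace_def
  proof (intro conjI ballI allI)
    show "0 \<in> {u. nilpotent_at a u}" by (auto simp: nilpotent_at_def intro!: exI[of _ 0])
    fix x y assume "x \<in> {u. nilpotent_at a u}" "y \<in> {u. nilpotent_at a u}"
    then obtain N N' where "(a ^^ N) x = 0" "(a ^^ N') y = 0" by (auto simp: nilpotent_at_def)
    then have "(a ^^ max N N') (x + y) = 0"
      using funpow_eq_0_mono[OF a, of N x "max N N'"] funpow_eq_0_mono[OF a, of N' y "max N N'"]
      by (simp add: lin)
    then show "x + y \<in> {u. nilpotent_at a u}" by (auto simp: nilpotent_at_def)
  next
    fix c x assume "x \<in> {u. nilpotent_at a u}"
    then show "smul c x \<in> {u. nilpotent_at a u}" by (auto simp: nilpotent_at_def lin intro!: exI)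
  qed
  then have "{u. nilpotent_at a u} = UNIV"
    using irreducible[of "{u. nilpotent_at a u}"] assms v_nonzero by auto
  then show ?thesis by blast
qed

text \<open>In each case \<open>c\<close> and \<open>e\<close> are the first and second brackets of
  the mode with \<open>Y k\<close>; the third bracket vanishes.\<close>

lemma nilpotent_Y:
  assumes "nilpotent_at (Y k) v"
  shows "nilpotent_at (Y k) u"
proof (rule nilpotent_everywhere[OF endo_Y assms])
  fix u n assume u: "nilpotent_at (Y k) u"
  show "nilpotent_at (Y k) (X n u)"
    by (rule nilpotent_at_bracket[OF endo_Y endo_X, where u = u
          and c = "\<lambda>u. H (n + k) u + smul (if n + k = 0 then of_int n else 0) u"
          and e = "\<lambda>u. smul (- 2) (Y (n + k + k) u)"])
      (auto simp: u XY HY YY H_simps Y_simps algebra_simps intro!: endoI)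
  show "nilpotent_at (Y k) (Y n u)"
    by (rule nilpotent_at_bracket[OF endo_Y endo_Y, where u = u and c = "\<lambda>u. 0" and e = "\<lambda>u. 0"])
      (auto simp: u YY Y_simps intro!: endoI)
  show "nilpotent_at (Y k) (H n u)"
    by (rule nilpotent_at_bracket[OF endo_Y endo_H, where u = u
          and c = "\<lambda>u. smul (- 2) (Y (n + k) u)" and e = "\<lambda>u. 0"])
      (auto simp: u HY YY Y_simps algebra_simps intro!: endoI)
next
  fix u assume u: "nilpotent_at (Y k) u"
  show "nilpotent_at (Y k) (D u)"
    by (rule nilpotent_at_bracket[OF endo_Y endo_D, where u = u
          and c = "\<lambda>u. smul (of_int k) (Y k u)" and e = "\<lambda>u. 0"])
      (auto simp: u DY Y_simps algebra_simps intro!: endoI)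
qed

lemma nilpotent_X:
  assumes "nilpotent_at (X k) v"
  shows "nilpotent_at (X k) u"
proof (rule nilpotent_everywhere[OF endo_X assms])
  fix u n assume u: "nilpotent_at (X k) u"
  show "nilpotent_at (X k) (Y n u)"
    by (rule nilpotent_at_bracket[OF endo_X endo_Y, where u = u
          and c = "\<lambda>u. - H (k + n) u - smul (if k + n = 0 then of_int k else 0) u"
          and e = "\<lambda>u. smul (- 2) (X (k + n + k) u)"])
      (auto simp: u YX HX XX H_simps X_simps algebra_simps intro!: endoI)
  show "nilpotent_at (X k) (X n u)"
    by (rule nilpotent_at_bracket[OF endo_X endo_X, where u = u and c = "\<lambda>u. 0" and e = "\<lambda>u. 0"])
      (auto simp: u XX X_simps intro!: endoI)
  show "nilpotent_at (X k) (H n u)"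
    by (rule nilpotent_at_bracket[OF endo_X endo_H, where u = u
          and c = "\<lambda>u. smul 2 (X (n + k) u)" and e = "\<lambda>u. 0"])
      (auto simp: u HX XX X_simps algebra_simps intro!: endoI)
next
  fix u assume u: "nilpotent_at (X k) u"
  show "nilpotent_at (X k) (D u)"
    by (rule nilpotent_at_bracket[OF endo_X endo_D, where u = u
          and c = "\<lambda>u. smul (of_int k) (X k u)" and e = "\<lambda>u. 0"])
      (auto simp: u DX X_simps algebra_simps intro!: endoI)
qed

lemma nilpotent_Y_nonneg: "k \<ge> 0 \<Longrightarrow> nilpotent_at (Y k) u"
proof (rule nilpotent_Y)
  assume "k \<ge> 0"
  show "nilpotent_at (Y k) v"
  proof (cases "k = 0")
    case True
    have "(Y 0 ^^ (\<epsilon> + 1)) v = 0"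
      using dpow_Y0_v by (simp only: funpow_eq_0_iff of_nat_add of_nat_1)
    then show ?thesis unfolding nilpotent_at_def True by blast
  next
    case False
    then have "(Y k ^^ 1) v = 0"
      using singular_positive(2)[OF singular_v, of k] \<open>k \<ge> 0\<close> by simp
    then show ?thesis unfolding nilpotent_at_def by blast
  qed
qed

lemma nilpotent_X_minus_1: "nilpotent_at (X (- 1)) u"
proof (rule nilpotent_X)
  have "(X (- 1) ^^ (2 - \<epsilon>)) v = 0"
    using dpow_X1_v eps by (simp add: funpow_eq_0_iff of_nat_diff)
  then show "nilpotent_at (X (- 1)) v" unfolding nilpotent_at_def by blast
qed

subsection \<open>Weights and the vectors \<open>w m\<close>\<close>

text \<open>This formula and \<open>Y_dpow_X\<close> are mostly applied to vanishing divided powers,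
  where they become linear relations between shorter products.\<close>

lemma X_dpow_Y: "X j (dpow (Y k) p u) = dpow (Y k) p (X j u) + dpow (Y k) (p - 1) (H (j + k) u)
    + smul (if j + k = 0 then of_int j else 0) (dpow (Y k) (p - 1) u) - dpow (Y k) (p - 2) (Y (j + 2 * k) u)"
proof -
  have "X j (dpow (Y k) p u) = dpow (Y k) p (X j u)
      + dpow (Y k) (p - 1) (H (j + k) u + smul (if j + k = 0 then of_int j else 0) u)
      + smul (1 / 2) (dpow (Y k) (p - 2) (smul (- 2) (Y (j + 2 * k) u)))"
    by (rule dpow_bracket2[where a = "Y k" and b = "X j"
          and c = "\<lambda>u. H (j + k) u + smul (if j + k = 0 then of_int j else 0) u"])
      (auto simp: XY HY YY H_simps Y_simps algebra_simps intro!: endoI endo_X endo_Y)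
  then show ?thesis by (simp add: dpow_Y_simps add.assoc)
qed

lemma Y_dpow_X: "Y j (dpow (X k) p u) = dpow (X k) p (Y j u) - H (j + k) (dpow (X k) (p - 1) u)
    - smul (if j + k = 0 then of_int k else 0) (dpow (X k) (p - 1) u) + dpow (X k) (p - 2) (X (j + 2 * k) u)"
proof -
  have "Y j (dpow (X k) p u) = dpow (X k) p (Y j u)
      + (- H (j + k) (dpow (X k) (p - 1) u) - smul (if j + k = 0 then of_int k else 0) (dpow (X k) (p - 1) u))
      - smul (1 / 2) (dpow (X k) (p - 2) (smul (- 2) (X (j + 2 * k) u)))"
    by (rule dpow_bracket2'[where a = "X k" and b = "Y j"
          and c = "\<lambda>u. - H (j + k) u - smul (if j + k = 0 then of_int k else 0) u"])
      (auto simp: YX HX XX H_simps X_simps algebra_simps intro!: endoI endo_X endo_Y)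
  then show ?thesis by (simp add: dpow_X_simps algebra_simps)
qed

lemma H_dpow_Y: "H j (dpow (Y k) p u) = dpow (Y k) p (H j u) - smul 2 (Y (j + k) (dpow (Y k) (p - 1) u))"
proof -
  have "H j (dpow (Y k) p u) = dpow (Y k) p (H j u) + dpow (Y k) (p - 1) (smul (- 2) (Y (j + k) u))"
    by (rule dpow_bracket1[where a = "Y k" and c = "H j"])
      (auto simp: HY YY Y_simps algebra_simps intro!: endoI endo_H endo_Y)
  then show ?thesis by (simp add: dpow_Y_simps Y_dpow_Y)
qed

lemma H_dpow_X: "H j (dpow (X k) p u) = dpow (X k) p (H j u) + smul 2 (X (j + k) (dpow (X k) (p - 1) u))"
proof -
  have "H j (dpow (X k) p u) = dpow (X k) p (H j u) + dpow (X k) (p - 1) (smul 2 (X (j + k) u))"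
    by (rule dpow_bracket1[where a = "X k" and c = "H j"])
      (auto simp: HX XX X_simps algebra_simps intro!: endoI endo_H endo_X)
  then show ?thesis by (simp add: dpow_X_simps X_dpow_X)
qed

lemma funpow_eigen:
  assumes "endo smul a" "endo smul c" "\<And>u. c (a u) = a (c u) + smul t (a u)" "c b = smul x b"
  shows "c ((a ^^ p) b) = smul (x + t * of_nat p) ((a ^^ p) b)"
  by (induction p)
    (simp_all add: assms(3,4) endo_simps[OF assms(1)] algebra_simps flip: scale_left_distrib)

text \<open>Reflecting a weight vector by the two simple reflections lowers \<open>s\<close> by one.\<close>

lemma weight_bound:
  assumes "b \<noteq> 0" "H 0 b = smul (of_nat (\<epsilon> + 2 * s)) b" "D b = smul (\<delta> + of_int t) b"
  shows "t + int s * int s + int \<epsilon> * int s \<le> 0"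
  using assms
proof (induction s arbitrary: b t)
  case 0
  have "G b = smul (4 * (\<delta> + of_int t) + of_nat \<epsilon>) b"
    using 0 by (simp add: G_def algebra_simps)
  then obtain j where "4 * (\<delta> + of_int t) + of_nat \<epsilon> = 4 * \<delta> + of_nat \<epsilon> - of_nat j"
    using singular_bound[OF singular_v v_nonzero G_v] 0(1) by blast
  then have "of_int (4 * t + int j) = (of_int 0 :: complex)" by (simp add: algebra_simps)
  then have "4 * t + int j = 0" by (simp only: of_int_eq_iff)
  then show ?case by simp
next
  case (Suc s)
  \<comment> \<open>For the affine simple root \<open>b\<close> has weight
    \<open>\<epsilon> + 2 * (s + 1) - 1\<close>, which is the exponent. This reflection takes the
    weight under \<open>H 0\<close> to \<open>- (\<epsilon> + 2 * s)\<close>, and the one defining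
    \<open>b2\<close> reverses its sign.\<close>
  define b1 where "b1 = (Y 1 ^^ (\<epsilon> + 2 * s + 1)) b"
  define b2 where "b2 = (X 0 ^^ (\<epsilon> + 2 * s)) b1"
  have "b1 \<noteq> 0"
  proof
    assume "b1 = 0"
    moreover have "H 0 b - smul (of_int 1) b = smul (of_nat (\<epsilon> + 2 * s + 1)) b"
      using Suc.prems(2) scale_left_distrib[of 1 1 b] by (simp add: algebra_simps)
    ultimately have "b = 0"
      using sl2_triple.weight_reflection_injective[OF triple_XY[of 1], of b "\<epsilon> + 2 * s + 1"]
        nilpotent_X_minus_1 by (simp add: b1_def)
    then show False using Suc.prems(1) by simp
  qed
  have H1: "H 0 b1 = smul (- of_nat (\<epsilon> + 2 * s)) b1"
    using funpow_eigen[OF endo_Y endo_H, of 0 1 "- 2", OF _ Suc.prems(2), of "\<epsilon> + 2 * s + 1"]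
    by (simp add: HY b1_def algebra_simps)
  have D1: "D b1 = smul (\<delta> + of_int (t + int (\<epsilon> + 2 * s + 1))) b1"
    using funpow_eigen[OF endo_Y endo_D, of 1 1, OF _ Suc.prems(3), of "\<epsilon> + 2 * s + 1"]
    by (simp add: DY b1_def algebra_simps)
  have "b2 \<noteq> 0"
  proof
    assume "b2 = 0"
    moreover have "smul (of_int 0) b1 - H 0 b1 = smul (of_nat (\<epsilon> + 2 * s)) b1"
      by (simp only: H1 of_int_0 scale_zero_left diff_0 scale_minus_left minus_minus)
    ultimately have "b1 = 0"
      using sl2_triple.weight_reflection_injective[OF triple_YX[of 0], of b1 "\<epsilon> + 2 * s"]
        nilpotent_Y_nonneg[of 0] by (simp add: b2_def)
    then show False using \<open>b1 \<noteq> 0\<close> by simp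
  qed
  moreover have "H 0 b2 = smul (of_nat (\<epsilon> + 2 * s)) b2"
    using funpow_eigen[OF endo_X endo_H, of 0 0 2, OF _ H1, of "\<epsilon> + 2 * s"]
    by (simp add: HX b2_def algebra_simps)
  moreover have "D b2 = smul (\<delta> + of_int (t + int (\<epsilon> + 2 * s + 1))) b2"
    using funpow_eigen[OF endo_X endo_D, of 0 0, OF _ D1, of "\<epsilon> + 2 * s"]
    by (simp add: DX b2_def)
  \<comment> \<open>The gain \<open>\<epsilon> + 2 * s + 1\<close> in the eigenvalue of
    \<open>D\<close> is the difference between the bounds for \<open>s + 1\<close> and
    \<open>s\<close>.\<close>
  ultimately have "t + int (\<epsilon> + 2 * s + 1) + int s * int s + int \<epsilon> * int s \<le> 0"
    by (rule Suc.IH)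
  then show ?case by (simp add: algebra_simps)
qed

section \<open>Extremality of the vectors \<open>w m\<close>\<close>

lemma Y_v: "j \<ge> int \<epsilon> \<Longrightarrow> Y j v = 0"
  using singular_positive(2)[OF singular_v, of j] dpow_Y0_v endo_Y[of 0]
  by (cases "j = 0") simp_all

text \<open>A non-zero vector here would violate \<open>weight_bound\<close> at
  \<open>s = m + 1\<close>, by exactly \<open>m + 1\<close>.\<close>

lemma dpow_X_v: "dpow (X (- int (m + \<epsilon>))) (int m + 1) v = 0" (is "?b = 0")
proof (rule ccontr)
  assume "?b \<noteq> 0"
  moreover have "H 0 ?b = smul (of_nat (\<epsilon> + 2 * (m + 1))) ?b"
    using dpow_eigen[OF endo_X endo_H, of 0 "- int (m + \<epsilon>)" 2 "int m + 1" v]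
    by (simp add: HX H0_v dpow_X_simps flip: scale_left_distrib)
  moreover have "D ?b = smul (\<delta> + of_int (- int (m + \<epsilon>) * (int m + 1))) ?b"
    using dpow_eigen[OF endo_X endo_D, of "- int (m + \<epsilon>)" "of_int (- int (m + \<epsilon>))" "int m + 1" v]
    by (simp add: DX D_v dpow_X_simps flip: scale_left_distrib)
  ultimately have "- int (m + \<epsilon>) * (int m + 1) + int (m + 1) * int (m + 1) + int \<epsilon> * int (m + 1) \<le> 0"
    by (rule weight_bound)
  then show False by (simp add: algebra_simps)
qed

lemma dpow_X_v':
  assumes "p > int m"
  shows "dpow (X (- int (m + \<epsilon>))) p v = 0"
proof -
  have "(X (- int (m + \<epsilon>)) ^^ (m + 1)) v = 0"
    using dpow_X_v[of m] by (simp only: funpow_eq_0_iff of_nat_add of_nat_1)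
  then have "(X (- int (m + \<epsilon>)) ^^ nat p) v = 0"
    by (rule funpow_eq_0_mono[OF endo_X]) (use assms in simp)
  then show ?thesis using assms by (simp only: funpow_eq_0_iff) simp
qed

text \<open>The vector \<open>w_n\<close> for \<open>n = 2 * m + \<epsilon>\<close>, with both
  parities treated at once.\<close>

definition w :: "nat \<Rightarrow> 'v" where "w m = dpow (X (- int (m + \<epsilon>))) (int m) v"

text \<open>Applying \<open>Y (j - 2 * k)\<close> with \<open>k = - (m + \<epsilon>)\<close> to the
  vanishing divided power of exponent \<open>m + 2\<close> leaves only the second-order term, which
  is \<open>X j (w m)\<close>.\<close>

lemma X_w:
  assumes "j \<ge> - int (2 * m + \<epsilon>)"
  shows "X j (w m) = 0"
proof -
  define k where "k = - int (m + \<epsilon>)"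
  have "dpow (X k) (int m + 2) v = 0" "dpow (X k) (int m + 1) v = 0"
    by (simp_all add: k_def dpow_X_v' del: of_nat_add)
  moreover have "Y (j - 2 * k) v = 0"
    by (rule Y_v) (use assms in \<open>simp add: k_def\<close>)
  ultimately have "dpow (X k) (int m) (X j v) = 0"
    using Y_dpow_X[of "j - 2 * k" k "int m + 2" v]
    by (simp add: Y_simps H_simps dpow_X_simps add.commute)
  then show ?thesis by (simp only: w_def X_dpow_X k_def)
qed

text \<open>The vector \<open>H i (w m)\<close> is computed twice: the null vector of exponent
  \<open>m + 1\<close> gives some vector, and direct commutation gives twice that vector.\<close>

lemma H_w:
  assumes "i > 0"
  shows "H i (w m) = 0"
proof -
  define k where "k = - int (m + \<epsilon>)"
  have w: "w m = dpow (X k) (int m) v" by (simp only: w_def k_def)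
  have "dpow (X k) (int m + 1) v = 0"
    by (simp add: k_def dpow_X_v' del: of_nat_add)
  moreover have "Y (i - k) v = 0"
    by (rule Y_v) (use assms in \<open>simp add: k_def\<close>)
  ultimately have "H i (w m) = X (i + k) (dpow (X k) (int m - 1) v)"
    using Y_dpow_X[of "i - k" k "int m + 1" v] assms
    by (simp add: w dpow_X_simps Y_simps X_dpow_X add.commute)
  moreover have "H i (w m) = smul 2 (X (i + k) (dpow (X k) (int m - 1) v))"
    using H_dpow_X[of i k "int m" v] singular_positive(3)[OF singular_v, of i] assms
    by (simp add: w dpow_X_simps)
  ultimately show ?thesis
    using scale_left_distrib[of 1 1 "H i (w m)"] by simp
qed

lemma H0_w: "H 0 (w m) = smul (of_nat (2 * m + \<epsilon>)) (w m)"
  using dpow_eigen[OF endo_X endo_H, of 0 "- int (m + \<epsilon>)" 2 "int m" v]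
  by (simp add: w_def HX H0_v dpow_X_simps algebra_simps flip: scale_left_distrib)

text \<open>For the triple with raising operator \<open>Y (m + \<epsilon>)\<close>, the vector
  \<open>v\<close> has highest weight \<open>m\<close> and \<open>w m\<close> is the other end of
  its string.\<close>

lemma dpow_Y_w: "dpow (Y (int (m + \<epsilon>))) (int m) (w m) = v"
proof -
  have "smul (of_int (int (m + \<epsilon>))) v - H 0 v = smul (of_nat m) v"
    by (simp add: H0_v algebra_simps)
  then show ?thesis
    using sl2_triple.dpow_e_dpow_f[OF triple_YX, of "int (m + \<epsilon>)" v m m] Y_v
    by (simp add: w_def)
qed

subsection \<open>Recursion on the number of positive parts\<close>

text \<open>The properties of \<open>w_n\<close> used by the recursion, with \<open>N\<close> in the
  role of \<open>n\<close>.\<close>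

definition extremal :: "int \<Rightarrow> 'v \<Rightarrow> bool" where
  "extremal N u \<longleftrightarrow> (\<forall>j \<ge> - N. X j u = 0) \<and> (\<forall>i > 0. H i u = 0) \<and> H 0 u = smul (of_int N) u"

lemma extremal_w: "extremal (int (2 * m + \<epsilon>)) (w m)"
  by (simp add: extremal_def X_w H_w H0_w)

definition Hs :: "nat list \<Rightarrow> 'v \<Rightarrow> 'v" where
  "Hs fs u = foldr (\<lambda>j. H (- int j)) fs u"

definition Ys :: "int \<Rightarrow> nat list \<Rightarrow> 'v \<Rightarrow> 'v" where
  "Ys k ls u = foldr (\<lambda>l. Y (k - int l)) ls u"

lemma Hs_simps [simp]: "Hs [] u = u" "Hs (j # fs) u = H (- int j) (Hs fs u)"
  by (simp_all add: Hs_def)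

lemma Ys_simps [simp]: "Ys k [] u = u" "Ys k (l # ls) u = Y (k - int l) (Ys k ls u)"
  by (simp_all add: Ys_def)

lemma endo_Hs: "endo smul (Hs fs)"
  by (intro endoI) (induction fs; simp add: H_simps)+

lemma endo_Ys: "endo smul (Ys k ls)"
  by (intro endoI) (induction ls; simp add: Y_simps)+

lemma Y_Ys: "Y q (Ys k ls x) = Ys k ls (Y q x)"
  by (induction ls) (simp_all add: YY[of q])

text \<open>Passing \<open>H (- j)\<close> lowers the exponent of \<open>X\<close> by at most
  \<open>j\<close>, so it never falls below \<open>- N\<close>.\<close>

lemma X_Hs:
  assumes "extremal N u"
  shows "l + int (sum_list fs) \<le> N \<Longrightarrow> X (- l) (Hs fs u) = 0"
proof (induction fs arbitrary: l)
  case Nil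
  then show ?case using assms by (simp add: extremal_def)
next
  case (Cons j fs)
  have "X (- l) (Hs fs u) = 0" "X (- (l + int j)) (Hs fs u) = 0"
    using Cons.prems by (intro Cons.IH; simp)+
  then show ?case by (simp add: XH H_simps add.commute)
qed

lemma H0_Hs:
  assumes "extremal N u"
  shows "H 0 (Hs fs u) = smul (of_int N) (Hs fs u)"
proof (induction fs)
  case Nil
  then show ?case using assms by (simp add: extremal_def)
next
  case (Cons j fs)
  have "H 0 (H (- int j) x) = H (- int j) (H 0 x)" for x by (subst HH) simp
  then show ?case by (simp add: Cons H_simps)
qed

text \<open>The bound on \<open>fs\<close> makes \<open>X (- k)\<close> kill \<open>Hs fs u\<close>,
  which is therefore a highest weight vector of weight \<open>(k + r) - k = r\<close> for the triple
  on \<open>X (- k)\<close> and \<open>Y k\<close>.\<close>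

lemma dpow_Y_Hs_eq_0:
  assumes "extremal (k + int r) u" "k \<ge> 0" "sum_list fs \<le> r"
  shows "dpow (Y k) (int r + 1) (Hs fs u) = 0"
proof (rule sl2_triple.dpow_f_eq_0[OF triple_XY])
  show "X (- k) (Hs fs u) = 0" by (rule X_Hs[OF assms(1)]) (use assms(3) in simp)
  show "H 0 (Hs fs u) - smul (of_int k) (Hs fs u) = smul (of_nat r) (Hs fs u)"
    by (simp add: H0_Hs[OF assms(1)] algebra_simps)
  show "nilpotent_at (Y k) (Hs fs u)" using assms(2) by (rule nilpotent_Y_nonneg)
qed

text \<open>\<open>Y k\<close> raised to its top power implements a Weyl reflection, which maps \<open>H (- j)\<close> to
  \<open>- H (- j)\<close>.\<close>

lemma dpow_Y_Hs:
  assumes "extremal (k + int r) u" "k \<ge> 0"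
  shows "0 \<notin> set fs \<Longrightarrow> sum_list fs \<le> r \<Longrightarrow>
    dpow (Y k) (int r) (Hs fs u) = smul ((- 1) ^ length fs) (Hs fs (dpow (Y k) (int r) u))"
proof (induction fs)
  case (Cons j fs)
  define g where "g = Hs fs u"
  define A where "A = dpow (Y k) (int r) (H (- int j) g)"
  define B where "B = H (- int j) (dpow (Y k) (int r) g)"
  have "X (- (k + int j)) g = 0"
    unfolding g_def by (rule X_Hs[OF assms(1)]) (use Cons.prems in simp)
  moreover have "dpow (Y k) (int r + 1) g = 0"
    unfolding g_def by (rule dpow_Y_Hs_eq_0[OF assms]) (use Cons.prems in simp)
  \<comment> \<open>\<open>X (- (k + j))\<close>, applied to the vanishing power of exponent
    \<open>r + 1\<close>, trades the inner \<open>H (- j)\<close> for one factor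
    \<open>Y (k - j)\<close>.\<close>
  ultimately have A: "A = dpow (Y k) (int r - 1) (Y (k - int j) g)"
    using X_dpow_Y[of "- (k + int j)" k "int r + 1" g] Cons.prems
    by (simp add: A_def X_simps dpow_Y_simps)
  \<comment> \<open>By the relation just found, the correction term of the commutation is
    \<open>2 A\<close>; this produces the sign.\<close>
  have "B = A - smul 2 A"
    using H_dpow_Y[of "- int j" k "int r" g]
    by (simp add: A_def[symmetric] B_def) (simp add: A Y_dpow_Y)
  then have "A = - B"
    using scale_left_distrib[of 1 1 A] by simp
  then show ?case
    using Cons by (simp add: A_def B_def g_def[symmetric] H_simps)
qed simp

text \<open>A product of \<open>p\<close> operators of type \<open>y\<close>: one for each part in
  \<open>ls\<close>, the others belonging to zero parts and collected in a divided power. The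
  factors \<open>fs\<close> are carried along so that the recursion closes.\<close>

definition M :: "int \<Rightarrow> int \<Rightarrow> nat list \<Rightarrow> nat list \<Rightarrow> 'v \<Rightarrow> 'v" where
  "M k p ls fs u = Ys k ls (dpow (Y k) (p - int (length ls)) (Hs fs u))"

lemma H_Ys: "H (- int j) (Ys k ls x) = Ys k ls (H (- int j) x)
    - smul 2 (\<Sum>i<length ls. Ys k (ls[i := ls ! i + j]) x)"
proof (induction ls)
  case (Cons l ls)
  have "H (- int j) (Ys k (l # ls) x) =
      Y (k - int l) (H (- int j) (Ys k ls x)) - smul 2 (Ys k ((l + j) # ls) x)"
    by (simp add: HY algebra_simps)
  also have "Y (k - int l) (H (- int j) (Ys k ls x)) = Ys k (l # ls) (H (- int j) x)
      - smul 2 (\<Sum>i<length ls. Ys k (l # ls[i := ls ! i + j]) x)"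
    by (simp add: Cons Y_simps module_hom.sum[OF endo_Y[unfolded linear_iff_module_hom]])
  finally show ?case
    by (simp add: sum.lessThan_Suc_shift scale_right_distrib algebra_simps del: sum.lessThan_Suc)
qed simp

text \<open>Moving inwards, \<open>H (- j)\<close> enlarges a part in \<open>ls\<close> by
  \<open>j\<close>, turns a zero part into \<open>j\<close>, or joins \<open>fs\<close>. Solving for
  the second kind of term leaves vectors with one listed part fewer.\<close>

lemma M_Cons: "smul 2 (M k p (j # ls) fs u) =
    M k p ls (j # fs) u - H (- int j) (M k p ls fs u)
    - smul 2 (\<Sum>i<length ls. M k p (ls[i := ls ! i + j]) fs u)"
proof -
  define q where "q = p - int (length ls)"
  have "H (- int j) (M k p ls fs u) = Ys k ls (H (- int j) (dpow (Y k) q (Hs fs u)))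
    - smul 2 (\<Sum>i<length ls. M k p (ls[i := ls ! i + j]) fs u)"
    by (simp add: M_def H_Ys q_def)
  also have "H (- int j) (dpow (Y k) q (Hs fs u)) =
      dpow (Y k) q (Hs (j # fs) u) - smul 2 (Y (k - int j) (dpow (Y k) (q - 1) (Hs fs u)))"
    by (simp add: H_dpow_Y)
  also have "Ys k ls \<dots> = M k p ls (j # fs) u - smul 2 (M k p (j # ls) fs u)"
    by (simp add: M_def q_def endo_simps[OF endo_Ys] Y_Ys diff_diff_eq add.commute)
  finally show ?thesis by (simp add: algebra_simps)
qed

text \<open>The recursion above does not mention \<open>k\<close>, \<open>p\<close> and \<open>u\<close>, so the values of \<open>M\<close> are
  determined by those for \<open>ls = []\<close>.\<close>

lemma M_eqI:
  assumes base: "\<And>fs. 0 \<notin> set fs \<Longrightarrow> sum_list fs \<le> R \<Longrightarrow>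
      smul \<sigma> (dpow (Y k) p (Hs fs u)) = smul \<sigma>' (dpow (Y k') p' (Hs fs u'))"
  shows "0 \<notin> set ls \<Longrightarrow> 0 \<notin> set fs \<Longrightarrow> sum_list ls + sum_list fs \<le> R \<Longrightarrow>
    smul \<sigma> (M k p ls fs u) = smul \<sigma>' (M k' p' ls fs u')"
proof (induction "length ls" arbitrary: ls fs)
  case 0
  then show ?case using base[of fs] by (simp add: M_def)
next
  case (Suc n)
  then obtain j ls' where ls: "ls = j # ls'" and n: "n = length ls'" by (cases ls) auto
  have "smul \<sigma> (M k p ls' (j # fs) u) = smul \<sigma>' (M k' p' ls' (j # fs) u')"
    "smul \<sigma> (M k p ls' fs u) = smul \<sigma>' (M k' p' ls' fs u')"
    using Suc.prems by (intro Suc.hyps(1); simp add: ls n)+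
  \<comment> \<open>Merging \<open>j\<close> into another part preserves the total size, so the
    bound \<open>R\<close> persists.\<close>
  moreover have "smul \<sigma> (M k p (ls'[i := ls' ! i + j]) fs u) =
      smul \<sigma>' (M k' p' (ls'[i := ls' ! i + j]) fs u')" if "i < length ls'" for i
    using Suc.prems that set_update_subset_insert[of ls' i "ls' ! i + j"]
    by (intro Suc.hyps(1)) (auto simp: ls n sum_list_update)
  then have "(\<Sum>i<length ls'. smul (\<sigma> * 2) (M k p (ls'[i := ls' ! i + j]) fs u)) =
      (\<Sum>i<length ls'. smul (\<sigma>' * 2) (M k' p' (ls'[i := ls' ! i + j]) fs u'))"
    by (intro sum.cong) (simp_all add: mult.commute[of _ 2] flip: scale_scale)
  ultimately have "smul \<sigma> (smul 2 (M k p ls fs u)) = smul \<sigma>' (smul 2 (M k' p' ls fs u'))"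
    unfolding ls M_Cons
    by (simp add: scale_right_diff_distrib scale_left_commute[of _ 2] scale_sum_right
        flip: H_simps(5))
  then have "smul 2 (smul \<sigma> (M k p ls fs u)) = smul 2 (smul \<sigma>' (M k' p' ls fs u'))"
    by (simp add: mult.commute[of 2])
  then show ?case by (simp only: scale_cancel_left) simp
qed

section \<open>Comparison of consecutive extremal vectors\<close>

lemma Ys_replicate: "Ys k (replicate q l) x = smul (fact q) (dpow (Y (k - int l)) (int q) x)"
proof -
  have "Ys k (replicate q l) x = (Y (k - int l) ^^ q) x" by (induction q) simp_all
  then show ?thesis by (simp add: funpow_eq_dpow)
qed

text \<open>The vectors \<open>T q\<close> below interpolate between both sides; applying \<open>X (q + 2 - a)\<close> to the
  vanishing vector \<open>Z (q + 2)\<close> shows that \<open>(- 1) ^ q T q\<close> is linear in \<open>q\<close>.\<close>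

lemma dpow_Y_shift:
  assumes u: "extremal (a + int d) u" and a: "a \<ge> 0" and d: "d \<ge> 1"
  shows "dpow (Y (a - 1)) (int d - 1) (Y (a + int d - 1) u) = smul ((- 1) ^ (d - 1)) (dpow (Y a) (int d) u)"
proof -
  define Z where "Z q = dpow (Y (a - 1)) (int q) (dpow (Y a) (int d + 1 - int q) u)" for q
  define T where "T q = dpow (Y (a - 1)) (int q) (dpow (Y a) (int d - 1 - int q) (Y (a + int q) u))" for q
  define \<Omega> where "\<Omega> = dpow (Y a) (int d) u"
  \<comment> \<open>Up to a factorial, \<open>Z q\<close> is \<open>M\<close> with
    \<open>p = d + 1\<close> and \<open>q\<close> parts equal to 1. For \<open>ls = []\<close> such
    vectors vanish by \<open>dpow_Y_Hs_eq_0\<close>, and \<open>M_eqI\<close> with coefficient 0 on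
    the right transfers this.\<close>
  have Z: "Z q = 0" if "q \<le> d" for q
  proof -
    have "smul 1 (M a (int d + 1) (replicate q 1) [] u) = smul 0 (M a (int d + 1) (replicate q 1) [] u)"
      by (rule M_eqI[where R = d])
        (use that dpow_Y_Hs_eq_0[OF u a] in \<open>simp_all add: sum_list_replicate\<close>)
    then show ?thesis by (simp add: M_def Ys_replicate Z_def scale_eq_0_iff)
  qed
  have rec: "T q + smul 2 (T (q + 1)) + T (q + 2) = 0" if "q + 2 \<le> d" for q
  proof -
    define P where "P = int d - 1 - int q"
    define x where "x = dpow (Y a) P u"
    have "X (int q + 2 - a) u = 0" "H (int q + 2) u = 0" "H (int q + 1) u = 0"
      using u by (simp_all add: extremal_def)
    then have X: "X (int q + 2 - a) x = - dpow (Y a) (P - 2) (Y (a + int q + 2) u)"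
      and H: "H (int q + 1) x = - smul 2 (dpow (Y a) (P - 1) (Y (a + int q + 1) u))"
      using X_dpow_Y[of "int q + 2 - a" a P u] H_dpow_Y[of "int q + 1" a P u]
      by (simp_all add: x_def dpow_Y_simps Y_dpow_Y algebra_simps)
    have "0 = X (int q + 2 - a) (Z (q + 2))"
      using Z[OF that] by (simp add: X_simps)
    also have "Z (q + 2) = dpow (Y (a - 1)) (int q + 2) x"
      by (simp add: Z_def x_def P_def algebra_simps)
    also have "X (int q + 2 - a) \<dots> = dpow (Y (a - 1)) (int q + 2) (X (int q + 2 - a) x)
        + dpow (Y (a - 1)) (int q + 1) (H (int q + 1) x) - dpow (Y (a - 1)) (int q) (Y (a + int q) x)"
      using X_dpow_Y[of "int q + 2 - a" "a - 1" "int q + 2" x] by (simp add: algebra_simps)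
    also have "\<dots> = - dpow (Y (a - 1)) (int q + 2) (dpow (Y a) (P - 2) (Y (a + int q + 2) u))
        - smul 2 (dpow (Y (a - 1)) (int q + 1) (dpow (Y a) (P - 1) (Y (a + int q + 1) u)))
        - dpow (Y (a - 1)) (int q) (Y (a + int q) x)"
      by (simp only: X H dpow_Y_simps) simp
    also have "\<dots> = - T (q + 2) - smul 2 (T (q + 1)) - T q"
      by (simp add: T_def P_def x_def Y_dpow_Y algebra_simps)
    finally show ?thesis by (simp add: algebra_simps)
  qed
  have linear: "smul ((- 1) ^ q) (T q) = T 0 - smul (of_nat q) (T 0 + T 1)" if "q \<le> d" for q
    using that
  proof (induction q rule: induct_nat_012)
    case (ge2 q)
    have "smul ((- 1) ^ Suc (Suc q)) (T (Suc (Suc q))) =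
        smul 2 (smul ((- 1) ^ Suc q) (T (Suc q))) - smul ((- 1) ^ q) (T q)"
    proof -
      have "T (Suc (Suc q)) = - T q - smul 2 (T (Suc q))"
        using rec[of q] ge2.prems by (simp add: algebra_simps eq_neg_iff_add_eq_0)
      then show ?thesis by (simp add: scale_right_diff_distrib mult.commute)
    qed
    also have "\<dots> = smul 2 (T 0 - smul (of_nat (Suc q)) (T 0 + T 1)) - (T 0 - smul (of_nat q) (T 0 + T 1))"
      using ge2 by simp
    also have "\<dots> = T 0 - smul (of_nat (Suc (Suc q))) (T 0 + T 1)"
    proof -
      have "smul 2 x = x + x" "smul (c * 2) x = smul c x + smul c x" for c x
        using scale_left_distrib[of 1 1 x] scale_left_distrib[of 1 1 "smul c x"]
        by (simp_all add: mult.commute)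
      then show ?thesis by (simp add: algebra_simps)
    qed
    finally show ?case .
  qed simp_all
  have T0: "T 0 = smul (of_nat d) \<Omega>"
    using dpow_step[OF endo_Y, of a "int d - 1" u] by (simp add: T_def \<Omega>_def Y_dpow_Y)
  \<comment> \<open>The exponent of \<open>Y a\<close> in \<open>T d\<close> is \<open>- 1\<close>.
    Together with \<open>T 0\<close> this zero determines the linear function as
    \<open>(d - q) \<Omega>\<close>.\<close>
  have "T d = 0" by (simp add: T_def dpow_Y_simps)
  then have "T 0 - smul (of_nat d) (T 0 + T 1) = 0"
    using linear[OF order_refl] by (simp only: scale_zero_right)
  then have "T 0 = smul (of_nat d) (T 0 + T 1)"
    by (simp only: right_minus_eq)
  then have "smul (of_nat d) (T 0 + T 1) = smul (of_nat d) \<Omega>"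
    by (simp only: T0)
  then have T1: "T 0 + T 1 = \<Omega>" using d by (simp only: scale_cancel_left) simp
  have "smul ((- 1) ^ (d - 1)) (T (d - 1)) = smul (of_nat d - of_nat (d - 1)) \<Omega>"
    using linear[of "d - 1"] by (simp only: T1) (simp add: T0 scale_left_diff_distrib)
  also have "\<dots> = \<Omega>" using d by (simp add: of_nat_diff)
  finally have "smul ((- 1) ^ (d - 1)) (smul ((- 1) ^ (d - 1)) (T (d - 1))) = smul ((- 1) ^ (d - 1)) \<Omega>"
    by simp
  then have "T (d - 1) = smul ((- 1) ^ (d - 1)) \<Omega>"
    by (simp flip: power_mult_distrib)
  then show ?thesis using d by (simp add: T_def \<Omega>_def of_nat_diff algebra_simps)
qed

text \<open>The left side has highest weight \<open>m\<close> for the triple on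
  \<open>X (- k)\<close> and \<open>Y k\<close> with \<open>k = m + \<epsilon>\<close>, so it is
  recovered from its lowest vector. By \<open>dpow_Y_shift\<close> that vector is \<open>v\<close>
  up to sign, and raising \<open>v\<close> gives \<open>w m\<close>.\<close>

lemma Y_w_Suc: "Y (int (2 * m + \<epsilon>) + 1) (w (Suc m)) = smul ((- 1) ^ m) (w m)"
proof -
  define k where "k = int (m + \<epsilon>)"
  define x where "x = Y (int (2 * m + \<epsilon>) + 1) (w (Suc m))"
  have u: "extremal (k + 1 + int (Suc m)) (w (Suc m))"
    using extremal_w[of "Suc m"] by (simp add: k_def algebra_simps)
  have "dpow (Y k) (int m) x = smul ((- 1) ^ m) (dpow (Y (k + 1)) (int (Suc m)) (w (Suc m)))"
    using dpow_Y_shift[OF u] by (simp add: k_def x_def algebra_simps)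
  also have "dpow (Y (k + 1)) (int (Suc m)) (w (Suc m)) = v"
    using dpow_Y_w[of "Suc m"] by (simp add: k_def add.commute)
  finally have "dpow (X (- k)) (int m) (dpow (Y k) (int m) x) = smul ((- 1) ^ m) (w m)"
    by (simp only: dpow_X_simps w_def k_def)
  moreover have "dpow (X (- k)) (int m) (dpow (Y k) (int m) x) = dpow (Y k) (int m - int m) x"
  proof (rule sl2_triple.dpow_e_dpow_f[OF triple_XY])
    show "X (- k) x = 0"
      using u by (simp add: x_def XY extremal_def k_def Y_simps)
    show "H 0 x - smul (of_int k) x = smul (of_nat m) x"
      using H0_w[of "Suc m"] by (simp add: x_def HY k_def Y_simps algebra_simps flip: scale_left_distrib)
  qed simp
  ultimately show ?thesis by (simp add: x_def)
qed

text \<open>The comparison without normalising factors. \<open>M_eqI\<close> reduces it to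
  \<open>ls = []\<close>; there \<open>dpow_Y_Hs\<close> pulls out \<open>fs\<close> with the same
  factor up to the parity of \<open>length fs\<close> on both sides, and \<open>dpow_Y_shift\<close>
  with \<open>Y_w_Suc\<close> settles what remains.\<close>

lemma M_stable:
  assumes r: "int (2 * m + \<epsilon>) = k + int r" and k: "k \<ge> 0" and ls: "0 \<notin> set ls" "sum_list ls \<le> r"
  shows "smul ((- 1) ^ m) (M k (int r) ls [] (w m)) =
    smul ((- 1) ^ r) (M (k + 1) (int r + 1) ls [] (w (Suc m)))"
proof (rule M_eqI[where R = r])
  fix fs :: "nat list" assume fs: "0 \<notin> set fs" "sum_list fs \<le> r"
  have u: "extremal (k + int r) (w m)" using extremal_w[of m] by (simp only: r)
  have u': "extremal (k + 1 + int (Suc r)) (w (Suc m))"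
  proof -
    have "k + 1 + int (Suc r) = int (2 * Suc m + \<epsilon>)" using r by simp
    then show ?thesis using extremal_w[of "Suc m"] by (simp only:)
  qed
  have "smul ((- 1) ^ m) (dpow (Y k) (int r) (w m)) =
      smul ((- 1) ^ r) (dpow (Y (k + 1)) (int r + 1) (w (Suc m)))"
    using dpow_Y_shift[OF u'] k Y_w_Suc[of m] r
    by (simp add: algebra_simps dpow_Y_simps)
  then have "Hs fs (smul ((- 1) ^ m) (dpow (Y k) (int r) (w m))) =
      Hs fs (smul ((- 1) ^ r) (dpow (Y (k + 1)) (int r + 1) (w (Suc m))))" by simp
  then show "smul ((- 1) ^ m) (dpow (Y k) (int r) (Hs fs (w m))) =
      smul ((- 1) ^ r) (dpow (Y (k + 1)) (int r + 1) (Hs fs (w (Suc m))))"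
    using dpow_Y_Hs[OF u k fs] dpow_Y_Hs[OF u' _ fs(1)] k fs(2)
    by (simp add: endo_simps[OF endo_Hs] scale_left_commute[of _ "(- 1) ^ length fs"] add.commute
        del: scale_scale)
qed (use ls in simp_all)

end

section \<open>The modules in terms of modes\<close>

lemma basis_in_sl2: "sl2_x \<in> sl2" "sl2_h \<in> sl2" "sl2_y \<in> sl2"
  by (simp_all add: sl2_def trace_def sum_2 sl2_x_def sl2_h_def sl2_y_def)

lemma sl2_commutators:
  "commutator sl2_x sl2_y = sl2_h"
  "commutator sl2_h sl2_x = mat_scale 2 sl2_x" "commutator sl2_h sl2_y = mat_scale (- 2) sl2_y"
  "commutator A A = 0"
  by (simp_all add: commutator_def mat_scale_def vec_eq_iff forall_2 matrix_matrix_mult_def sum_2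
      sl2_x_def sl2_h_def sl2_y_def)

lemma sl2_form:
  "trace (sl2_x ** sl2_y) = 1" "trace (sl2_h ** sl2_h) = 2" "trace (sl2_h ** sl2_x) = 0"
  "trace (sl2_h ** sl2_y) = 0" "trace (sl2_x ** sl2_x) = 0" "trace (sl2_y ** sl2_y) = 0"
  by (simp_all add: trace_def matrix_matrix_mult_def sum_2 sl2_x_def sl2_h_def sl2_y_def)

lemma sl2_decompose:
  assumes "A \<in> sl2"
  shows "A = mat_scale (A $ 1 $ 2) sl2_x + mat_scale (A $ 1 $ 1) sl2_h + mat_scale (A $ 2 $ 1) sl2_y"
proof -
  have "A $ 2 $ 2 = - A $ 1 $ 1"
    using assms by (simp add: sl2_def trace_def sum_2 eq_neg_iff_add_eq_0 add.commute)
  then show ?thesis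
    by (simp add: vec_eq_iff forall_2 mat_scale_def sl2_x_def sl2_h_def sl2_y_def)
qed

lemma mat_scale_in_sl2: "A \<in> sl2 \<Longrightarrow> mat_scale s A \<in> sl2"
  by (simp add: sl2_def trace_def sum_2 mat_scale_def flip: distrib_left)

lemma sl2_add: "A \<in> sl2 \<Longrightarrow> B \<in> sl2 \<Longrightarrow> A + B \<in> sl2"
  by (simp add: sl2_def trace_add)

lemma affine_scale_loop: "affine_scale s (loop A m) = loop (mat_scale s A) m"
  by (auto simp: affine_scale_def loop_def lookup_single when_def Poly_Mapping.map.rep_eq
      intro!: poly_mapping_eqI)

lemma affine_scale_simps: "affine_scale 1 u = u" "affine_scale 0 u = 0"
  by (cases u; simp add: affine_scale_def zero_prod_def)+

lemma affine_sl2_simps: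
  "A \<in> sl2 \<Longrightarrow> loop A m \<in> affine_sl2" "central_c \<in> affine_sl2" "degree_d \<in> affine_sl2"
  "affine_scale s central_c \<in> affine_sl2" "affine_scale s degree_d \<in> affine_sl2" "0 \<in> affine_sl2"
  by (auto simp: affine_sl2_def loop_def central_c_def degree_d_def lookup_single when_def
      affine_scale_def zero_prod_def) (simp_all add: sl2_def)

lemma loop_add: "loop (A + B) m = loop A m + loop B m"
  by (simp add: loop_def single_add)

lemma loop_0: "loop 0 m = 0"
  by (simp add: loop_def zero_prod_def)

lemma cartan_basis: "loop sl2_h 0 \<in> cartan" "central_c \<in> cartan" "degree_d \<in> cartan"
proof -
  have "affine_scale a (loop sl2_h 0) + affine_scale b central_c + affine_scale e degree_d \<in> cartan"
    for a b e by (auto simp: cartan_def)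
  from this[of 1 0 0] this[of 0 1 0] this[of 0 0 1] show
    "loop sl2_h 0 \<in> cartan" "central_c \<in> cartan" "degree_d \<in> cartan"
    by (simp_all add: affine_scale_simps)
qed

context affine_sl2_module
begin

lemma act_0: "act 0 u = 0"
  using act_scale[of 0 0 u] by (simp add: affine_sl2_simps affine_scale_simps)

lemma act_loop_scale: "A \<in> sl2 \<Longrightarrow> act (loop (mat_scale s A) m) u = smul s (act (loop A m) u)"
  using act_scale[of "loop A m" s u] by (simp add: affine_sl2_simps affine_scale_loop)

lemma act_loop_add:
  "A \<in> sl2 \<Longrightarrow> B \<in> sl2 \<Longrightarrow> act (loop (A + B) m) u = act (loop A m) u + act (loop B m) u"
  by (simp add: loop_add act_add affine_sl2_simps)

lemma act_loop_loop:
  assumes A: "A \<in> sl2" and B: "B \<in> sl2"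
  shows "act (loop A m) (act (loop B n) u) = act (loop B n) (act (loop A m) u)
    + act (loop (commutator A B) (m + n)) u
    + smul (if m + n = 0 then of_int m * trace (A ** B) else 0) (act central_c u)"
proof -
  have C: "commutator A B \<in> sl2"
    by (simp add: sl2_def commutator_def trace_sub trace_mul_sym[of A B])
  have "m = - n \<longleftrightarrow> m + n = 0" by auto
  then have "act (affine_bracket (loop A m) (loop B n)) u = act (loop (commutator A B) (m + n)) u
    + smul (if m + n = 0 then of_int m * trace (A ** B) else 0) (act central_c u)"
    unfolding affine_bracket_loop_loop
    by (subst act_add) (auto simp: affine_sl2_simps C act_scale)
  then show ?thesis
    using act_bracket[of "loop A m" "loop B n" u] by (simp add: affine_sl2_simps A B algebra_simps)
qed

lemma act_d_loop:
  assumes "A \<in> sl2"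
  shows "act degree_d (act (loop A m) u) = act (loop A m) (act degree_d u) + smul (of_int m) (act (loop A m) u)"
  using act_bracket[of degree_d "loop A m" u] assms
  by (simp add: affine_sl2_simps affine_bracket_d_loop act_loop_scale algebra_simps)

lemma act_central_commute: "u' \<in> affine_sl2 \<Longrightarrow> act central_c (act u' u) = act u' (act central_c u)"
  using act_bracket[of central_c u' u] by (simp add: affine_sl2_simps affine_bracket_central act_0)

text \<open>Every element is a finite sum of modes of \<open>x\<close>, \<open>h\<close>,
  \<open>y\<close> plus multiples of \<open>c\<close> and \<open>d\<close>. This carries
  irreducibility over to the mode operators.\<close>

lemma submoduleI:
  assumes W: "subspace W"
    and "\<And>w m. w \<in> W \<Longrightarrow> act (loop sl2_x m) w \<in> W" "\<And>w m. w \<in> W \<Longrightarrow> act (loop sl2_y m) w \<in> W"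
      "\<And>w m. w \<in> W \<Longrightarrow> act (loop sl2_h m) w \<in> W"
    and "\<And>w. w \<in> W \<Longrightarrow> act degree_d w \<in> W" "\<And>w. w \<in> W \<Longrightarrow> act central_c w \<in> W"
  shows "submodule W"
  unfolding submodule_def
proof (intro conjI ballI W)
  fix u w assume u: "u \<in> affine_sl2" and w: "w \<in> W"
  obtain f a b where fab: "u = (f, a, b)" by (cases u)
  have f: "Poly_Mapping.lookup f m \<in> sl2" for m using u by (simp add: fab affine_sl2_def)
  have loop: "act (loop A m) w \<in> W" if "A \<in> sl2" for A m
  proof -
    have "act (loop A m) w = act (loop (mat_scale (A $ 1 $ 2) sl2_x) m) w
        + act (loop (mat_scale (A $ 1 $ 1) sl2_h) m) w + act (loop (mat_scale (A $ 2 $ 1) sl2_y) m) w"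
      by (subst sl2_decompose[OF that])
        (simp only: act_loop_add sl2_add mat_scale_in_sl2 basis_in_sl2)
    then show ?thesis
      using assms w by (simp add: act_loop_scale basis_in_sl2 subspace_add subspace_scale)
  qed
  have sum_in: "(\<Sum>m\<in>K. loop (Poly_Mapping.lookup f m) m) \<in> affine_sl2" if "finite K" for K
    using that
  proof induction
    case (insert m K)
    then show ?case using f[of m]
      by (auto simp: affine_sl2_def loop_def lookup_add lookup_single when_def sl2_def trace_add split: prod.splits)
  qed (simp add: affine_sl2_simps)
  have sum_act: "act (\<Sum>m\<in>K. loop (Poly_Mapping.lookup f m) m) w \<in> W" if "finite K" for K
    using that
  proof induction
    case empty
    then show ?case by (simp add: act_0 subspace_0[OF W])
  next
    case (insert m K)
    then show ?case using f[of m] sum_in[of K] loop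
      by (simp add: act_add affine_sl2_simps subspace_add[OF W])
  qed
  let ?S = "\<Sum>m\<in>Poly_Mapping.keys f. loop (Poly_Mapping.lookup f m) m"
  have fS: "(f, 0, 0) = ?S"
  proof -
    have "(\<Sum>m\<in>K. loop (Poly_Mapping.lookup f m) m) = (\<Sum>m\<in>K. Poly_Mapping.single m (Poly_Mapping.lookup f m), 0, 0)"
      if "finite K" for K
      using that by induction (simp_all add: loop_def zero_prod_def)
    moreover have "(\<Sum>m\<in>Poly_Mapping.keys f. Poly_Mapping.single m (Poly_Mapping.lookup f m)) = f"
      by (rule poly_mapping_eqI)
        (simp add: lookup_sum lookup_single when_def in_keys_iff)
    ultimately show ?thesis by simp
  qed
  have "u = ?S + (affine_scale a central_c + affine_scale b degree_d)"
    unfolding fS[symmetric] by (simp add: fab affine_scale_def central_c_def degree_d_def)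
  moreover have "affine_scale a central_c + affine_scale b degree_d \<in> affine_sl2"
    by (simp add: affine_scale_def central_c_def degree_d_def affine_sl2_def sl2_def)
  ultimately have "act u w = act ?S w + (smul a (act central_c w) + smul b (act degree_d w))"
    by (simp add: act_add sum_in affine_sl2_simps act_scale)
  then show "act u w \<in> W"
    using sum_act[of "Poly_Mapping.keys f"] assms w by (simp add: subspace_add subspace_scale)
qed

end

text \<open>The vectors fixed by the central element form a submodule containing
  \<open>v0\<close>.\<close>

lemma (in irreducible_highest_weight_module) act_central:
  assumes "\<Lambda> central_c = 1"
  shows "act central_c u = u"
proof -
  note lin = act_linear[OF affine_sl2_simps(2)]
  have "submodule {u. act central_c u = u}"
    unfolding submodule_def subspace_def
    by (auto simp: act_central_commute linear_iff_module_hom[THEN iffD1, OF lin, THEN module_hom.add]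
        linear_iff_module_hom[THEN iffD1, OF lin, THEN module_hom.scale]
        linear_iff_module_hom[THEN iffD1, OF lin, THEN module_hom.zero])
  moreover have "act central_c v0 = v0" "v0 \<noteq> 0"
    using highest_weight_vector cartan_basis(2) assms by (auto simp: highest_weight_vector_def)
  ultimately have "{u. act central_c u = u} = UNIV"
    using irreducible by (auto simp: irreducible_module_def)
  then show ?thesis by blast
qed

lemma fundamental_weight_values:
  "\<epsilon> \<le> 1 \<Longrightarrow> fundamental_weight \<epsilon> (loop sl2_h 0) = of_nat \<epsilon>"
  "\<epsilon> \<le> 1 \<Longrightarrow> fundamental_weight \<epsilon> central_c = 1"
  by (cases \<epsilon>; simp add: fundamental_weight_def Lambda1_def weight_values)+

lemma level_one_fundamental:
  assumes "irreducible_highest_weight_module smul act (fundamental_weight \<epsilon>) v" and \<epsilon>: "\<epsilon> \<le> 1"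
  shows "level_one smul (\<lambda>m. act (loop sl2_x m)) (\<lambda>m. act (loop sl2_y m)) (\<lambda>m. act (loop sl2_h m))
    (act degree_d) \<epsilon> (fundamental_weight \<epsilon> degree_d) v"
proof -
  interpret irreducible_highest_weight_module smul act "fundamental_weight \<epsilon>" v by (rule assms)
  have c: "act central_c u = u" for u
    by (rule act_central) (rule fundamental_weight_values(2)[OF \<epsilon>])
  note v = highest_weight_vector[unfolded highest_weight_vector_def]
  note brackets = act_loop_loop[OF basis_in_sl2(1) basis_in_sl2(3)]
    act_loop_loop[OF basis_in_sl2(2) basis_in_sl2(1)]
    act_loop_loop[OF basis_in_sl2(2) basis_in_sl2(3)]
    act_loop_loop[OF basis_in_sl2(2) basis_in_sl2(2)]
    act_loop_loop[OF basis_in_sl2(1) basis_in_sl2(1)]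
    act_loop_loop[OF basis_in_sl2(3) basis_in_sl2(3)]
  note b = brackets[unfolded sl2_commutators sl2_form c act_loop_scale[OF basis_in_sl2(1)]
    act_loop_scale[OF basis_in_sl2(3)] loop_0 act_0]
  have L: "endo smul (act (loop sl2_x m))" "endo smul (act (loop sl2_y m))"
    "endo smul (act (loop sl2_h m))" "endo smul (act degree_d)" for m
    by (intro act_linear affine_sl2_simps basis_in_sl2)+
  show ?thesis
  proof (intro level_one.intro level_one_axioms.intro)
    show "complex_space smul" by unfold_locales
    fix m n u
    show "act (loop sl2_x m) (act (loop sl2_y n) u) = act (loop sl2_y n) (act (loop sl2_x m) u)
        + act (loop sl2_h (m + n)) u + smul (if m + n = 0 then of_int m else 0) u"
      using b(1)[of m n u] by simp
    show "act (loop sl2_h m) (act (loop sl2_x n) u) = act (loop sl2_x n) (act (loop sl2_h m) u)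
        + smul 2 (act (loop sl2_x (m + n)) u)"
      using b(2)[of m n u] by simp
    show "act (loop sl2_h m) (act (loop sl2_y n) u) = act (loop sl2_y n) (act (loop sl2_h m) u)
        - smul 2 (act (loop sl2_y (m + n)) u)"
      using b(3)[of m n u] by simp
    show "act (loop sl2_h m) (act (loop sl2_h n) u) = act (loop sl2_h n) (act (loop sl2_h m) u)
        + smul (if m + n = 0 then 2 * of_int m else 0) u"
      using b(4)[of m n u] by (simp add: mult.commute)
    show "act (loop sl2_x m) (act (loop sl2_x n) u) = act (loop sl2_x n) (act (loop sl2_x m) u)"
      using b(5)[of m n u] by simp
    show "act (loop sl2_y m) (act (loop sl2_y n) u) = act (loop sl2_y n) (act (loop sl2_y m) u)"
      using b(6)[of m n u] by simp
  next
    fix W assume W: "subspace W" "\<And>w n. w \<in> W \<Longrightarrow> act (loop sl2_x n) w \<in> W \<and>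
      act (loop sl2_y n) w \<in> W \<and> act (loop sl2_h n) w \<in> W \<and> act degree_d w \<in> W"
    have "submodule W" by (rule submoduleI[OF W(1)]) (use W(2) in \<open>auto simp: c\<close>)
    then show "W = {0} \<or> W = UNIV" using irreducible by (auto simp: irreducible_module_def)
  next
    show "act (loop sl2_h 0) v = smul (of_nat \<epsilon>) v"
      using v cartan_basis(1) fundamental_weight_values(1)[OF \<epsilon>] by metis
  qed (use v cartan_basis \<epsilon> in \<open>blast intro: L act_d_loop basis_in_sl2\<close>)+
qed

section \<open>Partitions, normalising factors and the conclusion\<close>

lemma partition_nonzero:
  assumes "is_partition \<mu>"
  shows "\<mu> i \<noteq> 0 \<longleftrightarrow> i < partition_supp \<mu>"
proof -
  have fin: "finite {i. \<mu> i \<noteq> 0}" and anti: "antimono \<mu>"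
    using assms by (auto simp: is_partition_def)
  have down: "\<mu> i \<noteq> 0" if "\<mu> j \<noteq> 0" "i \<le> j" for i j
    using antimonoD[OF anti that(2)] that(1) by simp
  obtain N where N: "\<mu> N = 0"
    using fin infinite_UNIV_nat by (metis (mono_tags, lifting) UNIV_eq_I mem_Collect_eq)
  define s where "s = (LEAST i. \<mu> i = 0)"
  have "\<mu> s = 0" unfolding s_def by (rule LeastI[of _ N]) (rule N)
  then have s: "\<mu> i \<noteq> 0 \<longleftrightarrow> i < s" for i
    using down[of i s] not_less_Least[of i "\<lambda>i. \<mu> i = 0", folded s_def] by linarith
  then have "{i. \<mu> i \<noteq> 0} = {..<s}" by blast
  then show ?thesis using s by (simp add: partition_supp_def)
qed

lemma foldr_funpow: "foldr (\<lambda>_. f) xs u = (f ^^ length xs) u"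
  by (induction xs) simp_all

context level_one
begin

text \<open>The zero parts come last and contribute an ordinary power of \<open>Y k\<close>; its
  factorial will cancel the one for multiplicity 0 in \<open>norm_coeff\<close>.\<close>

lemma foldr_Y_partition:
  assumes \<mu>: "is_partition \<mu>" and "partition_supp \<mu> \<le> r"
  shows "foldr (\<lambda>i. Y (k - int (\<mu> i))) [0..<r] u = smul (fact (r - partition_supp \<mu>))
    (M k (int r) (map \<mu> [0..<partition_supp \<mu>]) [] u)"
proof -
  define s where "s = partition_supp \<mu>"
  have s: "[0..<r] = [0..<s] @ [s..<r]"
    using assms(2) upt_add_eq_append[of 0 s "r - s"] by (simp add: s_def)
  have zero: "\<mu> i = 0" if "i \<ge> s" for i
    using partition_nonzero[OF \<mu>, of i] that by (simp add: s_def)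
  have "foldr (\<lambda>i. Y (k - int (\<mu> i))) [s..<r] u = foldr (\<lambda>i. Y k) [s..<r] u"
    by (rule foldr_cong) (simp_all add: zero)
  also have "\<dots> = (Y k ^^ length [s..<r]) u"
    by (rule foldr_funpow)
  also have "\<dots> = (Y k ^^ (r - s)) u" by simp
  also have "\<dots> = smul (fact (r - s)) (dpow (Y k) (int r - int s) u)"
    using assms(2) by (simp add: funpow_eq_dpow of_nat_diff s_def)
  finally show ?thesis
    using endo_simps(5)[OF endo_Ys, of k "map \<mu> [0..<s]"]
    by (simp add: s M_def Ys_def foldr_map o_def flip: s_def)
qed

lemma weyl_vector_w:
  assumes "\<epsilon> = n mod 2" and X: "\<And>m. act (loop sl2_x m) = X m"
  shows "weyl_vector smul act v n = w (n div 2)"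
proof (cases "even n")
  case True
  then have "\<epsilon> = 0" using assms by presburger
  then show ?thesis using True unfolding w_def by (simp add: weyl_vector_def dpow_def X)
next
  case False
  then have "\<epsilon> = 1" "(n + 1) div 2 = n div 2 + 1" "(n - 1) div 2 = n div 2"
    using assms by presburger+
  then show ?thesis using False unfolding w_def by (simp add: weyl_vector_def dpow_def X nat_add_distrib)
qed

end

text \<open>The factor for zero parts is split off, ready for cancellation. The exponent of
  \<open>- 1\<close> matters only modulo 2, so the difference becomes a sum.\<close>

lemma norm_coeff_eq:
  "norm_coeff (n, k, \<mu>) = (- 1) ^ (n div 4 + (n - k) div 2) /
    (fact (n - k - partition_supp \<mu>) * (\<Prod>j=1..k. fact (card {i. \<mu> i = j})))"
proof -
  have "(- 1 :: complex) powi (int a - int b) = (- 1) ^ (a + b)" for a b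
    by (simp add: power_int_diff power_add divide_inverse flip: power_inverse)
  moreover have "(\<Prod>j=0..k. fact (part_mult (n, k, \<mu>) j) :: complex) =
      fact (n - k - partition_supp \<mu>) * (\<Prod>j=1..k. fact (card {i. \<mu> i = j}))"
    by (subst prod.atLeast_Suc_atMost) (auto simp: part_mult_def intro!: prod.cong)
  ultimately show ?thesis by (simp add: norm_coeff_def)
qed

theorem theorem6:
  fixes smul :: "complex \<Rightarrow> 'v::ab_group_add \<Rightarrow> 'v"
    and act :: "affine \<Rightarrow> 'v \<Rightarrow> 'v"
    and v :: 'v
    and n :: nat and \<xi> :: pattern
  assumes "irreducible_highest_weight_module smul act (fundamental_weight (n mod 2)) v"
    and "\<xi> \<in> stable_patterns n"
  shows "basis_vector smul act v \<xi> = basis_vector smul act v (pattern_shift \<xi>)"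
proof -
  obtain k \<mu> where \<xi>: "\<xi> = (n, k, \<mu>)" and k: "k \<le> n" and \<mu>: "is_partition \<mu>" "\<mu> 0 \<le> k"
    and supp: "partition_supp \<mu> \<le> n - k" and size: "partition_size \<mu> \<le> n - k"
    using assms(2) by (auto simp: stable_patterns_def patterns_def split: if_splits)
  define r where "r = n - k"
  define s where "s = partition_supp \<mu>"
  define m where "m = n div 2"
  define ls where "ls = map \<mu> [0..<s]"
  define P :: complex where "P = (\<Prod>j=1..k. fact (card {i. \<mu> i = j}))"
  interpret level_one smul "\<lambda>m. act (loop sl2_x m)" "\<lambda>m. act (loop sl2_y m)"
    "\<lambda>m. act (loop sl2_h m)" "act degree_d" "n mod 2" "fundamental_weight (n mod 2) degree_d" v
    by (rule level_one_fundamental[OF assms(1)]) simp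
  have "int (2 * m + n mod 2) = int k + int r" using k by (simp add: m_def r_def)
  moreover have "0 \<notin> set ls"
    by (auto simp: ls_def s_def simp flip: partition_nonzero[OF \<mu>(1)])
  moreover have "sum_list ls \<le> r"
    using size
    by (simp add: ls_def r_def s_def partition_size_def partition_nonzero[OF \<mu>(1)]
        interv_sum_list_conv_sum_set_nat atLeast0LessThan lessThan_def del: neq0_conv)
  ultimately have stable: "smul ((- 1) ^ m) (M (int k) (int r) ls [] (w m)) =
      smul ((- 1) ^ r) (M (int k + 1) (int r + 1) ls [] (w (Suc m)))"
    by (intro M_stable) simp_all
  have "basis_vector smul act v \<xi> = smul (norm_coeff (n, k, \<mu>) * fact (r - s)) (M (int k) (int r) ls [] (w m))"
    using foldr_Y_partition[OF \<mu>(1) supp, of "int k" "w m"]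
    by (simp add: \<xi> basis_vector_def weyl_vector_w r_def s_def ls_def m_def)
  also have "norm_coeff (n, k, \<mu>) * fact (r - s) = (- 1) ^ (n div 4 + r div 2) / P"
    by (simp add: norm_coeff_eq r_def s_def P_def)
  \<comment> \<open>The square of \<open>(- 1) ^ m\<close> is inserted so that \<open>stable\<close>
    applies.\<close>
  also have "smul ((- 1) ^ (n div 4 + r div 2) / P) (M (int k) (int r) ls [] (w m)) =
      smul ((- 1) ^ (n div 4 + r div 2 + m) / P) (smul ((- 1) ^ m) (M (int k) (int r) ls [] (w m)))"
    by (simp add: power_add flip: power_mult_distrib)
  also have "\<dots> = smul ((- 1) ^ (n div 4 + r div 2 + m + r) / P) (M (int k + 1) (int r + 1) ls [] (w (Suc m)))"
    unfolding stable by (simp add: power_add)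
  \<comment> \<open>Hermite's identity gives \<open>n div 4 + (n + 2) div 4 = n div 2\<close>, and
    \<open>r div 2 + (r + 1) div 2 = r\<close>; so the sign in \<open>norm_coeff\<close> absorbs the
    sign from \<open>stable\<close>.\<close>
  also have "(- 1 :: complex) ^ (n div 4 + r div 2 + m + r) = (- 1) ^ ((n + 2) div 4 + (r + 1) div 2)"
  proof -
    have "even (n div 4 + r div 2 + m + r) \<longleftrightarrow> even ((n + 2) div 4 + (r + 1) div 2)"
      unfolding m_def by presburger
    then show ?thesis by (simp only: minus_one_power_iff)
  qed
  also have "(- 1) ^ ((n + 2) div 4 + (r + 1) div 2) / P = norm_coeff (n + 2, k + 1, \<mu>) * fact (r + 1 - s)"
  proof -
    \<comment> \<open>The largest part is at most \<open>k\<close>, so the new factor in the product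
      is \<open>fact 0\<close>.\<close>
    have "\<mu> i \<noteq> k + 1" for i
      using \<mu> antimonoD[of \<mu> 0 i] by (auto simp: is_partition_def)
    then have "{i. \<mu> i = k + 1} = {}" by blast
    then have "(\<Prod>j=1..k + 1. fact (card {i. \<mu> i = j})) = P"
      by (simp add: P_def prod.nat_ivl_Suc')
    moreover have "n + 2 - (k + 1) = r + 1" using k by (simp add: r_def)
    ultimately show ?thesis by (simp only: norm_coeff_eq) (simp add: s_def)
  qed
  also have "smul \<dots> (M (int k + 1) (int r + 1) ls [] (w (Suc m))) = basis_vector smul act v (pattern_shift \<xi>)"
  proof -
    have "n + 2 - (k + 1) = r + 1" using k by (simp add: r_def)
    moreover have "partition_supp \<mu> \<le> r + 1" using supp by (simp add: r_def)
    ultimately show ?thesis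
      using foldr_Y_partition[OF \<mu>(1), of "r + 1" "int k + 1" "w (Suc m)"]
      by (simp add: \<xi> pattern_shift_def basis_vector_def weyl_vector_w s_def ls_def m_def add.commute)
  qed
  finally show ?thesis .
qed

end
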